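(* Consider $N$ Euler–Lagrange systems $$M_i(q_i)\ddot q_i+C_i(q_i,\dot q_i)\dot q_i+G_i(q_i)=\tau_i,\quad i=1,\dots,N,$$ with $q_i,\tau_i\in\mathbb{R}^n$, satisfying: (P1) $M_i(q_i)$ is symmetric and uniformly positive definite; (P2) for all $a',b\in\mathbb{R}^n$, $M_i(q_i)a'+C_i(q_i,\dot q_i)b+G_i(q_i)=Y_i(q_i,\dot q_i,a',b)\Theta_i$ with $Y_i$ a known regression matrix and $\Theta_i\in\mathbb{R}^p$ an unknown constant vector; (P3) $\dot M_i(q_i)-2C_i(q_i,\dot q_i)$ is skew-symmetric for all $q_i,\dot q_i$. Let $l$ be a positive integer, $m=2l$, $a=\begin{bmatrix}0&1\\-1&0\end{bmatrix}$, $S(z)=\mathrm{diag}(z)\otimes a$ for $z\in\mathbb{R}^l$, and let the leader be $\dot v=S(\omega)v$, $q_0=Cv$, where $v\in\mathbb{R}^m$, $C\in\mathbb{R}^{n\times m}$ is known, and $\omega=\mathrm{col}(\omega_{01},\dots,\omega_{0l})\in\mathbb{R}^l$ is an unknown vector with $\omega_{0k}>0$ for all $k$. Let $\bar{\mathcal G}$ be a digraph on nodes $\{0,1,\dots,N\}$ (node $0$ the leader, node $i$ the $i$-th Euler–Lagrange system) that contains a spanning tree rooted at node $0$, and such that the subgraph $\mathcal G$ on $\{1,\dots,N\}$ (obtained by removing all edges between node $0$ and the other nodes) is undirected; let $\bar{\mathcal N}_i=\{j:(j,i)\text{ is an edge of }\bar{\mathcal G}\}$. Consider the control law, for $i=1,\dots,N$,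 $$\tau_i=-K_is_i+Y_i\hat\Theta_i,\quad \dot{\hat\Theta}_i=-\Lambda_i^{-1}Y_i^Ts_i,$$ $$\dot\eta_i=S(\omega_i)\eta_i+\mu_1e_{vi},\quad \dot\omega_i=\mu_2\phi(e_{vi})\eta_i,\quad e_{vi}=\sum_{j\in\bar{\mathcal N}_i}(\eta_j-\eta_i),\ \eta_0=v,$$ where $\dot q_{ri}=CS(\omega_i)\eta_i-\alpha(q_i-C\eta_i)$, $s_i=\dot q_i-\dot q_{ri}$, $\ddot q_{ri}=CS(\omega_i)\dot\eta_i+CS(\dot\omega_i)\eta_i-\alpha(\dot q_i-C\dot\eta_i)$, $Y_i=Y_i(q_i,\dot q_i,\ddot q_{ri},\dot q_{ri})$ is the regression matrix from (P2) so that $Y_i\Theta_i=M_i(q_i)\ddot q_{ri}+C_i(q_i,\dot q_i)\dot q_{ri}+G_i(q_i)$, $\alpha>0$, $\mu_1,\mu_2>0$, $K_i$ are positive definite matrices, $\Lambda_i$ are diagonal matrices with positive diagonal entries, and for $x\in\mathbb{R}^m$, $\phi(x)\in\mathbb{R}^{l\times m}$ has $k$-th row with entry $-x_{2k}$ in column $2k-1$, $x_{2k-1}$ in column $2k$, and zeros elsewhere. Then for any initial conditions $q_i(0),\dot q_i(0),v(0),\eta_i(0),\omega_i(0),\hat\Theta_i(0)$, the closed-loop trajectories $q_i(t),\dot q_i(t),\eta_i(t),\omega_i(t),\hat\Theta_i(t)$ exist and are bounded for all $t\ge0$, and for $i=1,\dots,N$, $$\lim_{t\to\infty}(q_i(t)-q_0(t))=0,\qquad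 \lim_{t\to\infty}(\dot q_i(t)-\dot q_0(t))=0.$$
   Context: $\otimes$ is the Kronecker product; $\mathrm{col}(\cdot)$ stacks vectors into a column. The matrix $S(\omega)$ of the leader is skew-symmetric with all eigenvalues semi-simple and on the imaginary axis; the vector $\omega$ is not known to any follower and is not used by the control law.
   Formalization: The inertia matrices M_i are assumed differentiable and C_i, G_i and the regression matrices Y_i continuous in all arguments; without such regularity closed-loop trajectories need not exist (e.g. G_i the indicator of the rationals). *)

theory Defs
  imports "HOL-Analysis.Analysis"
begin

section \<open>Index type for the two components of each 2x2 block\<close>

text \<open>R^m with m = 2l is represented as real^('l \<times> half): the index (k,H1) stands
  for coordinate 2k-1 and (k,H2) for coordinate 2k.\<close>

datatype half = H1 | H2

lemma UNIV_half: "(UNIV :: half set) = {H1, H2}"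
  using half.exhaust by auto

instance half :: finite
  by standard (simp add: UNIV_half)

section \<open>Matrices used by the leader and the adaptive observer\<close>

definition kron :: "real^'b^'a \<Rightarrow> real^'d^'c \<Rightarrow> real^('b \<times> 'd)^('a \<times> 'c)" where
  "kron A B = (\<chi> r. \<chi> c. A $ fst r $ fst c * B $ snd r $ snd c)"

definition diagm :: "real^'a \<Rightarrow> real^'a^'a" where
  "diagm z = (\<chi> i. \<chi> j. if i = j then z $ i else 0)"

text \<open>a = [[0,1],[-1,0]]\<close>
definition amat :: "real^half^half" where
  "amat = (\<chi> h. \<chi> h'. if h = H1 \<and> h' = H2 then 1 else if h = H2 \<and> h' = H1 then -1 else 0)"

text \<open>S(z) = diag(z) \<otimes> a\<close>
definition Smat :: "real^'l \<Rightarrow> real^('l \<times> half)^('l \<times> half)" where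
  "Smat z = kron (diagm z) amat"

text \<open>phi(x): k-th row has -x_{2k} in column 2k-1, x_{2k-1} in column 2k, zeros elsewhere.\<close>
definition phi :: "real^('l \<times> half) \<Rightarrow> real^('l \<times> half)^'l" where
  "phi x = (\<chi> k. \<chi> c. if fst c = k then
       (if snd c = H1 then - (x $ (k, H2)) else x $ (k, H1)) else 0)"

section \<open>Matrix notions\<close>

definition pos_def_mat :: "real^'n^'n \<Rightarrow> bool" where
  "pos_def_mat K \<longleftrightarrow> transpose K = K \<and> (\<forall>x. x \<noteq> 0 \<longrightarrow> x \<bullet> (K *v x) > 0)"

definition pos_diag_mat :: "real^'n^'n \<Rightarrow> bool" where
  "pos_diag_mat L \<longleftrightarrow> (\<forall>i j. i \<noteq> j \<longrightarrow> L $ i $ j = 0) \<and> (\<forall>i. L $ i $ i > 0)"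

section \<open>Graphs\<close>

text \<open>A digraph on vertex set V with edge relation E (E j i means (j,i) is an edge)
  contains a spanning tree rooted at r: a sub-relation T of E which is a directed
  spanning tree (arborescence) of V rooted at r.\<close>
definition has_spanning_tree_rooted :: "'a set \<Rightarrow> ('a \<Rightarrow> 'a \<Rightarrow> bool) \<Rightarrow> 'a \<Rightarrow> bool" where
  "has_spanning_tree_rooted V E r \<longleftrightarrow> r \<in> V \<and>
     (\<exists>T. (\<forall>x y. T x y \<longrightarrow> E x y \<and> x \<in> V \<and> y \<in> V) \<and>
          (\<forall>x. \<not> T x r) \<and>
          (\<forall>y \<in> V - {r}. \<exists>!x. T x y) \<and>
          (\<forall>y \<in> V. (r, y) \<in> {(x, y). T x y}\<^sup>*))"

text \<open>In-neighbours of node i in the graph on {0..N}.\<close>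
definition nbrs :: "nat \<Rightarrow> (nat \<Rightarrow> nat \<Rightarrow> bool) \<Rightarrow> nat \<Rightarrow> nat set" where
  "nbrs N E i = {j \<in> {0..N}. E j i}"

section \<open>The closed-loop system\<close>

text \<open>Trajectories on [0,\<infinity>): v (leader), and for followers i: q i, qd i (velocity),
  eta i, om i (omega_i), th i (Theta-hat_i).  M, Cc, G, Y are the Euler-Lagrange data,
  Cm the leader output matrix C, om0 the leader frequency vector omega.\<close>
definition closed_loop ::
  "nat \<Rightarrow> (nat \<Rightarrow> nat \<Rightarrow> bool)
   \<Rightarrow> (nat \<Rightarrow> real^'n \<Rightarrow> real^'n^'n)
   \<Rightarrow> (nat \<Rightarrow> real^'n \<Rightarrow> real^'n \<Rightarrow> real^'n^'n)
   \<Rightarrow> (nat \<Rightarrow> real^'n \<Rightarrow> real^'n)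
   \<Rightarrow> (nat \<Rightarrow> real^'n \<Rightarrow> real^'n \<Rightarrow> real^'n \<Rightarrow> real^'n \<Rightarrow> real^'p^'n)
   \<Rightarrow> (nat \<Rightarrow> real^'n^'n) \<Rightarrow> (nat \<Rightarrow> real^'p^'p)
   \<Rightarrow> real^('l \<times> half)^'n \<Rightarrow> real \<Rightarrow> real \<Rightarrow> real \<Rightarrow> real^'l
   \<Rightarrow> (real \<Rightarrow> real^('l \<times> half))
   \<Rightarrow> (nat \<Rightarrow> real \<Rightarrow> real^'n) \<Rightarrow> (nat \<Rightarrow> real \<Rightarrow> real^'n)
   \<Rightarrow> (nat \<Rightarrow> real \<Rightarrow> real^('l \<times> half)) \<Rightarrow> (nat \<Rightarrow> real \<Rightarrow> real^'l)
   \<Rightarrow> (nat \<Rightarrow> real \<Rightarrow> real^'p) \<Rightarrow> bool" where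
  "closed_loop N E M Cc G Y K Lam Cm alpha mu1 mu2 om0 v q qd eta om th \<longleftrightarrow>
    (\<forall>t\<ge>0. (v has_vector_derivative (Smat om0 *v v t)) (at t within {0..})) \<and>
    (\<forall>i\<in>{1..N}. \<forall>t\<ge>0.
      let etaN = (\<lambda>j. if j = 0 then v t else eta j t);
          e = (\<Sum>j\<in>nbrs N E i. etaN j - eta i t);
          etad = Smat (om i t) *v eta i t + mu1 *\<^sub>R e;
          omd = mu2 *\<^sub>R (phi e *v eta i t);
          qrd = Cm *v (Smat (om i t) *v eta i t) - alpha *\<^sub>R (q i t - Cm *v eta i t);
          qrdd = Cm *v (Smat (om i t) *v etad) + Cm *v (Smat omd *v eta i t)
                 - alpha *\<^sub>R (qd i t - Cm *v etad);
          s = qd i t - qrd;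
          Yi = Y i (q i t) (qd i t) qrdd qrd;
          tau = - (K i *v s) + Yi *v th i t
      in (q i has_vector_derivative qd i t) (at t within {0..}) \<and>
         (\<exists>acc. (qd i has_vector_derivative acc) (at t within {0..}) \<and>
                M i (q i t) *v acc + Cc i (q i t) (qd i t) *v qd i t + G i (q i t) = tau) \<and>
         (eta i has_vector_derivative etad) (at t within {0..}) \<and>
         (om i has_vector_derivative omd) (at t within {0..}) \<and>
         (th i has_vector_derivative (- (matrix_inv (Lam i) *v (transpose Yi *v s))))
            (at t within {0..}))"

end

theory Submission
  imports Defs "HOL-Complex_Analysis.Great_Picard"
begin

text \<open>
  Put \<open>x\<^sub>i = \<eta>\<^sub>i - v\<close> and let \<open>H\<close> be the grounded Laplacian, which is symmetric because the follower graph is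
  undirected and positive definite because of the spanning tree; then \<open>e\<^sub>v = - H x\<close>. Along the observer,
  \<open>V = x\<^sup>T H x / 2 + \<Sum>|\<omega>\<^sub>i - \<omega>|\<^sup>2 / (2 \<mu>\<^sub>2)\<close> satisfies \<open>V' = - \<mu>\<^sub>1 \<Sum>|e\<^sub>v\<^sub>i|\<^sup>2\<close>: the update law of \<open>\<omega>\<^sub>i\<close> cancels the
  term with \<open>S(\<omega>\<^sub>i - \<omega>)\<close>, and \<open>S(\<omega>)\<close> contributes nothing since it is skew and commutes with \<open>H\<close>. Barbalat's
  lemma gives \<open>e\<^sub>v \<rightarrow> 0\<close>, hence \<open>x \<rightarrow> 0\<close>, and once more \<open>x' \<rightarrow> 0\<close>. No convergence of \<open>\<omega>\<^sub>i\<close> is needed.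

  For a follower, \<open>(s\<^sup>T M s + (\<theta> - \<Theta>)\<^sup>T \<Lambda> (\<theta> - \<Theta>)) / 2\<close> has derivative \<open>- s\<^sup>T K s\<close>, so \<open>s \<rightarrow> 0\<close> by Barbalat, and
  \<open>z = q\<^sub>i - C \<eta>\<^sub>i\<close> obeys the stable filter \<open>z' = - \<alpha> z + s - \<mu>\<^sub>1 C e\<^sub>v\<close> with vanishing input.

  The right-hand side of the closed loop is merely continuous, so existence comes from Peano's theorem. The
  Lyapunov bounds hold on every interval \<open>[0, T]\<close> and depend on the initial state only; the field can therefore
  be truncated outside a large ball without affecting the solution, which makes the solution global.
\<close>

section \<open>Peano existence with a priori bounds\<close>

text \<open>The number of nodes is a term and not a type, so the state is a function from
  \<open>nat\<close> to a Euclidean space, and continuity of the field refers to the product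
  topology. Solutions of a merely continuous field need not be unique: boundedness and convergence
  are therefore proved for every solution, and one a priori bound serves both existence and
  boundedness. The loop is a cascade. The observer never sees the plants, so its bounds come first;
  \<open>s\<close> and \<open>th\<close> are then bounded whatever the reference does; only
  afterwards is \<open>q\<close> bounded, as the output of a stable filter driven by
  \<open>s\<close> and by observer signals. The order matters because Barbalat's lemma asks for a
  bounded derivative of the dissipation rate. This derivative involves the acceleration, hence
  \<open>Cc\<close> and \<open>Y\<close>, and these are controlled along bounded
  trajectories.\<close>

lemma tendsto_fun_componentwise:
  fixes f :: "'c \<Rightarrow> ('i \<Rightarrow> 'b::topological_space)"
  shows "(f \<longlongrightarrow> l) F \<longleftrightarrow> (\<forall>i. ((\<lambda>c. f c i) \<longlongrightarrow> l i) F)"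
proof -
  have "(f \<longlongrightarrow> l) F \<longleftrightarrow> limitin (product_topology (\<lambda>i. euclidean) UNIV) f l F"
    by (simp add: euclidean_product_topology flip: limitin_canonical_iff)
  then show ?thesis
    by (simp add: limitin_componentwise)
qed

text \<open>Picard iterates of the delayed equation \<open>x' t = f (x (t - d))\<close>; because of the delay, the \<open>k\<close>-th
  iterate is already an exact solution on \<open>[0, k d]\<close>.\<close>

primrec tonelli :: "(('i \<Rightarrow> 'a) \<Rightarrow> 'i \<Rightarrow> 'a::euclidean_space) \<Rightarrow> ('i \<Rightarrow> 'a) \<Rightarrow> real \<Rightarrow> nat \<Rightarrow> 'i \<Rightarrow> real \<Rightarrow> 'a" where
  "tonelli f x0 d 0 = (\<lambda>i t. x0 i)"
| "tonelli f x0 d (Suc k) =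
     (\<lambda>i t. x0 i + integral {0..t} (\<lambda>s. f (\<lambda>j. tonelli f x0 d k j (s - d)) i))"

text \<open>Iterates are evaluated at \<open>s - d\<close>, possibly below 0, so the bound has to
  hold on the whole line. For negative \<open>t\<close> the interval \<open>{0..t}\<close> is empty
  and the integral is 0, hence the case split by sign.\<close>

lemma integral_atLeastAtMost_lipschitz:
  fixes g :: "real \<Rightarrow> 'a::euclidean_space"
  assumes cont: "continuous_on UNIV g" and bd: "\<And>s. norm (g s) \<le> B"
  shows "norm (integral {0..t} g - integral {0..u} g) \<le> B * \<bar>t - u\<bar>"
proof -
  have B: "0 \<le> B" using order_trans[OF norm_ge_zero bd[of 0]] .
  have int: "g integrable_on {a..b}" for a b
    by (intro integrable_continuous_real continuous_on_subset[OF cont]) auto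
  have *: "norm (integral {0..b} g - integral {0..a} g) \<le> B * (b - a)" if "a \<le> b" for a b
  proof -
    have seg: "norm (integral {c..b} g) \<le> B * (b - c)" if "c \<le> b" for c
      using integral_bound[OF that continuous_on_subset[OF cont]] bd by auto
    consider "b < 0" | "a < 0" "0 \<le> b" | "0 \<le> a" by linarith
    then show ?thesis
    proof cases
      case 1 then show ?thesis using that B by simp
    next
      case 2 
      have "norm (integral {0..b} g) \<le> B * (b - 0)" using seg 2 by blast
      also have "\<dots> \<le> B * (b - a)" using 2 B by (intro mult_left_mono) auto
      finally show ?thesis using 2 by simp
    next
      case 3
      have "integral {0..a} g + integral {a..b} g = integral {0..b} g"
        using Henstock_Kurzweil_Integration.integral_combine[of 0 a b g] 3 that int by auto
      then show ?thesis using seg[OF that] by (metis add_diff_cancel_left')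
    qed
  qed
  show ?thesis
    using *[of t u] *[of u t] by (cases "t \<le> u") (auto simp: norm_minus_commute abs_if)
qed

text \<open>The constant is the bound of \<open>f\<close>, independent of the delay and of the
  number of iterations, which makes the whole family equicontinuous. The induction also supplies the
  continuity of the iterate that the next integral presupposes.\<close>

lemma tonelli_lipschitz:
  assumes cont: "\<And>i. continuous_on UNIV (\<lambda>x. f x i)" and bd: "\<And>x i. norm (f x i) \<le> B"
  shows "norm (tonelli f x0 d k i t - tonelli f x0 d k i u) \<le> B * \<bar>t - u\<bar>"
proof -
  have B: "0 \<le> B" using order_trans[OF norm_ge_zero bd[of undefined undefined]] .
  show ?thesis
  proof (induction k arbitrary: i t u)
    case 0
    show ?case using B by simp
  next
    case (Suc k)
    have "continuous_on UNIV (\<lambda>s. tonelli f x0 d k j s)" for j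
    proof -
      have "B-lipschitz_on UNIV (\<lambda>s. tonelli f x0 d k j s)"
        using Suc B by (intro lipschitz_onI) (auto simp: dist_norm)
      then show ?thesis by (rule lipschitz_on_continuous_on)
    qed
    then have "continuous_on UNIV (\<lambda>s. tonelli f x0 d k j (s - d))" for j
      by (intro continuous_on_compose2[of UNIV "tonelli f x0 d k j" UNIV "\<lambda>s. s - d"])
        (auto intro!: continuous_intros)
    then have c: "continuous_on UNIV (\<lambda>s j. tonelli f x0 d k j (s - d))"
      by (intro continuous_on_coordinatewise_then_product) auto
    have "continuous_on UNIV (\<lambda>s. f (\<lambda>j. tonelli f x0 d k j (s - d)) i)"
      using continuous_on_compose2[OF cont c] by auto
    from integral_atLeastAtMost_lipschitz[OF this bd] show ?case by simp
  qed
qed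

text \<open>At time \<open>t\<close> the next iterate looks at its predecessor only up to
  \<open>t - d\<close>, so each iteration enlarges by \<open>d\<close> the interval on which the
  iterates have settled.\<close>

lemma tonelli_stable:
  assumes "d > 0" "t \<le> real k * d"
  shows "tonelli f x0 d (Suc k) i t = tonelli f x0 d k i t"
  using assms(2)
proof (induction k arbitrary: i t)
  case 0
  \<comment> \<open>For \<open>t \<le> 0\<close> the interval of integration is empty or a single
    point, so the first iterate still equals \<open>x0\<close>.\<close>
  then show ?case by (cases "t = 0") auto
next
  case (Suc k)
  have "tonelli f x0 d (Suc k) j (s - d) = tonelli f x0 d k j (s - d)" if "s \<in> {0..t}" for j s
    using that Suc.prems by (intro Suc.IH) (auto simp: algebra_simps)
  then have "integral {0..t} (\<lambda>s. f (\<lambda>j. tonelli f x0 d (Suc k) j (s - d)) i)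
     = integral {0..t} (\<lambda>s. f (\<lambda>j. tonelli f x0 d k j (s - d)) i)"
    by (intro integral_cong) presburger
  then show ?case by (metis tonelli.simps(2))
qed

text \<open>Arzela-Ascoli yields a convergent subsequence for one node on one interval; a diagonal
  argument over all pairs of node and interval yields one for everything. Pointwise limits are
  enough for passing to the limit under the integral by dominated convergence.\<close>

lemma lipschitz_family_converging_subsequence:
  fixes F :: "nat \<Rightarrow> nat \<Rightarrow> real \<Rightarrow> 'a::euclidean_space"
  assumes lip: "\<And>n i t u. norm (F n i t - F n i u) \<le> B * \<bar>t - u\<bar>"
    and init: "\<And>n i. F n i 0 = x0 i"
  obtains k x where "strict_mono (k :: nat \<Rightarrow> nat)" "\<And>i t. (\<lambda>n. F (k n) i t) \<longlonglongrightarrow> x i t"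
proof -
  \<comment> \<open>The index \<open>m\<close> codes a pair of a node and a radius, which makes the
    conditions a sequence that can be diagonalised.\<close>
  define P where "P m r \<longleftrightarrow> (\<forall>t\<in>{- real (snd (prod_decode m))..real (snd (prod_decode m))}.
     \<exists>l. (\<lambda>n. F (r n) (fst (prod_decode m)) t) \<longlonglongrightarrow> l)" for m and r :: "nat \<Rightarrow> nat"
  have B: "0 \<le> B" using order_trans[OF norm_ge_zero lip[of 0 0 1 0]] by simp
  obtain k :: "nat \<Rightarrow> nat" where k: "strict_mono k" "\<And>m. P m (id \<circ> k)"
  proof (rule subsequence_diagonalization_lemma[of P id])
    show "\<exists>k. strict_mono k \<and> P m (r \<circ> k)" for m and r :: "nat \<Rightarrow> nat"
    proof -
      obtain i K where iK: "prod_decode m = (i, K)" by fastforce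
      have bd: "norm (F (r n) i t) \<le> norm (x0 i) + B * real K" if "t \<in> {- real K..real K}" for n t
      proof -
        have "norm (F (r n) i t - x0 i) \<le> B * \<bar>t\<bar>" using lip[of "r n" i t 0] init by simp
        also have "\<dots> \<le> B * real K" using that B by (intro mult_left_mono) auto
        finally show ?thesis using norm_triangle_sub[of "F (r n) i t" "x0 i"] by linarith
      qed
      have eq: "\<exists>d. 0 < d \<and> (\<forall>n y. y \<in> {- real K..real K} \<and> norm (x - y) < d
             \<longrightarrow> norm (F (r n) i x - F (r n) i y) < e)" if "e > 0" for x e
      proof (intro exI[of _ "e / (B + 1)"] conjI allI impI)
        show "0 < e / (B + 1)" using that B by simp
        fix n y assume "y \<in> {- real K..real K} \<and> norm (x - y) < e / (B + 1)"
        then have "\<bar>x - y\<bar> * (B + 1) < e" using B by (simp add: field_simps)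
        then show "norm (F (r n) i x - F (r n) i y) < e"
          using lip[of "r n" i x y] by (simp add: algebra_simps)
      qed
      obtain g k where "strict_mono (k :: nat \<Rightarrow> nat)" and
        g: "\<And>e. 0 < e \<Longrightarrow> \<exists>N. \<forall>n x. n \<ge> N \<and> x \<in> {- real K..real K} \<longrightarrow> norm (F (r (k n)) i x - g x) < e"
        by (rule Arzela_Ascoli[of "{- real K..real K}" "\<lambda>n. F (r n) i", OF compact_Icc bd eq]) auto
      moreover have "(\<lambda>n. F (r (k n)) i t) \<longlonglongrightarrow> g t" if "t \<in> {- real K..real K}" for t
        unfolding LIMSEQ_def dist_norm using g that by meson
      ultimately show ?thesis unfolding P_def iK
        by (intro exI[of _ k]) (simp add: Ball_def, blast)
    qed
    \<comment> \<open>Convergence passes to any sequence whose terms, from \<open>N\<close> on, are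
      terms of the old one at least as late.\<close>
    show "P i (r \<circ> k2)" if P1: "P i (r \<circ> k1)" and sub: "\<And>j. N \<le> j \<Longrightarrow> \<exists>j'\<ge>j. k2 j = k1 j'"
      for i N and r k1 k2 :: "nat \<Rightarrow> nat"
    proof -
      have "\<exists>l. (\<lambda>n. g (k2 n)) \<longlonglongrightarrow> l" if "(\<lambda>n. g (k1 n)) \<longlonglongrightarrow> l" for l and g :: "nat \<Rightarrow> 'a"
        using that sub
        by (simp add: lim_sequentially) (metis (no_types, opaque_lifting) le_cases order_trans)
      from this[of "\<lambda>n. F (r n) (fst (prod_decode i)) _"] P1 show ?thesis
        unfolding P_def by fastforce
    qed
  qed auto
  have "\<exists>l. (\<lambda>n. F (k n) i t) \<longlonglongrightarrow> l" for i t
  proof -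
    obtain K :: nat where "\<bar>t\<bar> \<le> real K" using real_arch_simple by blast
    then have "t \<in> {- real K..real K}" by auto
    with k(2)[of "prod_encode (i, K)"] show ?thesis unfolding P_def by simp
  qed
  then show thesis using that[OF k(1), of "\<lambda>i t. SOME l. (\<lambda>n. F (k n) i t) \<longlonglongrightarrow> l"] by (metis someI_ex)
qed

theorem Peano_bounded:
  fixes f :: "(nat \<Rightarrow> 'a) \<Rightarrow> nat \<Rightarrow> 'a::euclidean_space"
  assumes cont: "\<And>i. continuous_on UNIV (\<lambda>x. f x i)" and bd: "\<And>x i. norm (f x i) \<le> B"
  obtains x where "\<And>i. x i 0 = x0 i"
    "\<And>i t. t \<ge> 0 \<Longrightarrow> (x i has_vector_derivative f (\<lambda>j. x j t) i) (at t within {0..})"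
proof -
  \<comment> \<open>\<open>n * Suc n\<close> iterations with delay \<open>1 / Suc n\<close> reach
    time \<open>n\<close>, so delay and horizon improve together.\<close>
  define F where "F n = tonelli f x0 (1 / real (Suc n)) (n * Suc n)" for n
  have lip: "norm (F n i t - F n i u) \<le> B * \<bar>t - u\<bar>" for n i t u
    unfolding F_def by (rule tonelli_lipschitz[OF cont bd])
  have init: "tonelli f x0 d k i 0 = x0 i" for d k i by (cases k) auto
  have Feq: "F n i t = x0 i + integral {0..t} (\<lambda>s. f (\<lambda>j. F n j (s - 1 / real (Suc n))) i)"
    if "t \<le> real n" for n i t
  proof -
    have "real (n * Suc n) * (1 / real (Suc n)) = real n"
      by (simp only: of_nat_mult) simp
    then have "F n i t = tonelli f x0 (1 / real (Suc n)) (Suc (n * Suc n)) i t"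
      unfolding F_def using that by (intro tonelli_stable[symmetric]) simp_all
    then show ?thesis unfolding F_def by simp
  qed
  obtain k x where k: "strict_mono (k :: nat \<Rightarrow> nat)" and lim: "\<And>i t. (\<lambda>n. F (k n) i t) \<longlonglongrightarrow> x i t"
    by (rule lipschitz_family_converging_subsequence[of F B x0, OF lip])
      (use init F_def in auto)
  have kn: "filterlim k at_top sequentially" using k filterlim_subseq by blast
  have B: "0 \<le> B" using order_trans[OF norm_ge_zero bd[of undefined undefined]] .
  have "B-lipschitz_on UNIV (x i)" for i
  proof (rule lipschitz_onI[OF _ B])
    fix t u
    have "(\<lambda>n. norm (F (k n) i t - F (k n) i u)) \<longlonglongrightarrow> norm (x i t - x i u)"
      by (intro tendsto_intros lim)
    from tendsto_upperbound[OF this, of "B * \<bar>t - u\<bar>"]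
    show "dist (x i t) (x i u) \<le> B * dist t u" using lip by (auto simp: dist_norm)
  qed
  then have xc: "continuous_on UNIV (x i)" for i by (rule lipschitz_on_continuous_on)
  then have gc: "continuous_on UNIV (\<lambda>s. f (\<lambda>j. x j s) i)" for i
    by (intro continuous_on_compose2[OF cont continuous_on_coordinatewise_then_product]) auto
  \<comment> \<open>The uniform Lipschitz bound makes the shift by the delay harmless in the
    limit.\<close>
  have delayed: "(\<lambda>n. F (k n) j (s - 1 / real (Suc (k n)))) \<longlonglongrightarrow> x j s" for j s
  proof -
    have "((\<lambda>n. 1 / real (Suc n)) \<longlongrightarrow> 0) at_top"
      using LIMSEQ_inverse_real_of_nat by (simp add: inverse_eq_divide)
    from filterlim_compose[OF this kn] have "(\<lambda>n. B * (1 / real (Suc (k n)))) \<longlonglongrightarrow> B * 0"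
      by (intro tendsto_mult tendsto_const)
    then have "(\<lambda>n. B * (1 / real (Suc (k n)))) \<longlonglongrightarrow> 0" by simp
    then have "(\<lambda>n. F (k n) j (s - 1 / real (Suc (k n))) - F (k n) j s) \<longlonglongrightarrow> 0"
    proof (rule Lim_null_comparison[rotated], intro always_eventually allI)
      fix n show "norm (F (k n) j (s - 1 / real (Suc (k n))) - F (k n) j s) \<le> B * (1 / real (Suc (k n)))"
        using lip[of "k n" j "s - 1 / real (Suc (k n))" s] by simp
    qed
    from tendsto_add[OF this lim[of j s]] show ?thesis by simp
  qed
  have ieq: "x i t = x0 i + integral {0..t} (\<lambda>s. f (\<lambda>j. x j s) i)" for i t
  proof -
    let ?g = "\<lambda>n s. f (\<lambda>j. F (k n) j (s - 1 / real (Suc (k n)))) i"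
    have "(\<lambda>n. integral {0..t} (?g n)) \<longlonglongrightarrow> integral {0..t} (\<lambda>s. f (\<lambda>j. x j s) i)"
    proof (rule dominated_convergence(2)[where h="\<lambda>_. B"])
      show "?g n integrable_on {0..t}" for n
      proof -
        have "B-lipschitz_on UNIV (F (k n) j)" for j
          using lip by (intro lipschitz_onI[OF _ B]) (auto simp: dist_norm)
        then have "continuous_on UNIV (F (k n) j)" for j
          by (rule lipschitz_on_continuous_on)
        then have "continuous_on UNIV (\<lambda>s. F (k n) j (s - 1 / real (Suc (k n))))" for j
          by (intro continuous_on_compose2[of UNIV "F (k n) j" UNIV "\<lambda>s. s - _"])
            (auto intro!: continuous_intros)
        then have "continuous_on UNIV (?g n)"
          by (intro continuous_on_compose2[OF cont continuous_on_coordinatewise_then_product]) auto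
        then show ?thesis
          by (intro integrable_continuous_real) (rule continuous_on_subset, auto)
      qed
      show "(\<lambda>n. ?g n s) \<longlonglongrightarrow> f (\<lambda>j. x j s) i" if "s \<in> {0..t}" for s
      proof -
        have "(\<lambda>n j. F (k n) j (s - 1 / real (Suc (k n)))) \<longlonglongrightarrow> (\<lambda>j. x j s)"
          using delayed by (simp add: tendsto_fun_componentwise)
        then show ?thesis
          by (rule continuous_on_tendsto_compose[OF cont]) auto
      qed
    qed (use bd in auto)
    then have "(\<lambda>n. x0 i + integral {0..t} (?g n)) \<longlonglongrightarrow> x0 i + integral {0..t} (\<lambda>s. f (\<lambda>j. x j s) i)"
      by (intro tendsto_intros)
    \<comment> \<open>For fixed \<open>t\<close> the delayed equation is exact as soon as
      \<open>k n\<close> reaches \<open>t\<close>, so the right-hand sides are eventually the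
      approximants themselves.\<close>
    moreover have "eventually (\<lambda>n. x0 i + integral {0..t} (?g n) = F (k n) i t) sequentially"
    proof -
      obtain m :: nat where m: "t \<le> real m" using real_arch_simple by blast
      have "eventually (\<lambda>n. k n \<ge> m) sequentially" using kn by (simp add: filterlim_at_top)
      then show ?thesis
        by eventually_elim (use m Feq[of t _ i] in auto)
    qed
    ultimately have "(\<lambda>n. F (k n) i t) \<longlonglongrightarrow> x0 i + integral {0..t} (\<lambda>s. f (\<lambda>j. x j s) i)"
      using tendsto_cong by fastforce
    then show ?thesis using lim LIMSEQ_unique by blast
  qed
  show thesis
  proof (rule that)
    show "x i 0 = x0 i" for i using ieq[of i 0] by simp
    show "(x i has_vector_derivative f (\<lambda>j. x j t) i) (at t within {0..})" if "t \<ge> 0" for i t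
    proof -
      have "((\<lambda>u. integral {0..u} (\<lambda>s. f (\<lambda>j. x j s) i)) has_vector_derivative f (\<lambda>j. x j t) i)
             (at t within {0..t+1})"
        by (rule integral_has_vector_derivative) (use gc that in \<open>auto intro: continuous_on_subset\<close>)
      then have "((\<lambda>u. x0 i + integral {0..u} (\<lambda>s. f (\<lambda>j. x j s) i)) has_vector_derivative f (\<lambda>j. x j t) i)
             (at t within {0..t+1})"
        by (auto intro!: derivative_eq_intros)
      then have "(x i has_vector_derivative f (\<lambda>j. x j t) i) (at t within {0..t+1})"
        unfolding ieq[symmetric] .
      moreover have "at t within {0..t+1} = at t within {0..}"
        by (rule at_within_nhd[of _ "{..<t+1}"]) auto
      ultimately show ?thesis by simp
    qed
  qed
qed

text \<open>The gap between \<open>R\<close> and the truncation radius \<open>R + 1\<close> closes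
  the argument: by continuity an escaping solution would have to cross it, but as long as it is
  inside the larger ball it solves the original equation and so stays within
  \<open>R\<close>.\<close>

theorem Peano_a_priori:
  fixes f :: "(nat \<Rightarrow> 'a) \<Rightarrow> nat \<Rightarrow> 'a::euclidean_space"
  assumes cont: "\<And>i. continuous_on UNIV (\<lambda>x. f x i)"
    and supp: "\<And>x i. i > N \<Longrightarrow> f x i = 0" "\<And>i. i > N \<Longrightarrow> x0 i = 0"
    and apriori: "\<And>T x i t. T \<ge> 0 \<Longrightarrow> (\<And>i. x i 0 = x0 i) \<Longrightarrow>
      (\<And>i t. t \<in> {0..T} \<Longrightarrow> (x i has_vector_derivative f (\<lambda>j. x j t) i) (at t within {0..T})) \<Longrightarrow>
      i \<le> N \<Longrightarrow> t \<in> {0..T} \<Longrightarrow> norm (x i t) \<le> R"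
  obtains x where "\<And>i. x i 0 = x0 i"
    "\<And>i t. t \<ge> 0 \<Longrightarrow> (x i has_vector_derivative f (\<lambda>j. x j t) i) (at t within {0..})"
proof -
  \<comment> \<open>On the one-point interval \<open>{0..0}\<close> a constant function solves every
    equation, so the a priori bound covers the initial state.\<close>
  have R0: "norm (x0 i) \<le> R" if "i \<le> N" for i
    by (rule apriori[of 0 "\<lambda>i t. x0 i" i 0])
      (use that in \<open>auto simp: has_vector_derivative_def has_derivative_within_singleton_iff bounded_linear_scaleR_left\<close>)
  then have R: "0 \<le> R" using order_trans[OF norm_ge_zero] by blast
  define Q where "Q = cball (0::'a) (R + 1)"
  have Q: "Q \<noteq> {}" "closed Q" "convex Q" "compact Q" using R by (auto simp: Q_def)
  define P where "P = closest_point Q"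
  have PQ: "P y \<in> Q" for y using Q by (simp add: P_def closest_point_in_set)
  have Pid: "P y = y" if "norm y \<le> R + 1" for y
    using that by (simp add: P_def Q_def closest_point_self)
  define g where "g x i = f (\<lambda>j. P (x j)) i" for x i
  have Pc: "continuous_on UNIV (\<lambda>(x::nat \<Rightarrow> 'a) j. P (x j))"
  proof (intro continuous_on_coordinatewise_then_product)
    fix j :: nat
    show "continuous_on UNIV (\<lambda>x::nat \<Rightarrow> 'a. P (x j))"
      unfolding P_def
      by (rule continuous_on_compose2[OF continuous_on_closest_point[OF Q(3,2,1), of UNIV]]) auto
  qed
  have gcont: "continuous_on UNIV (\<lambda>x. g x i)" for i
    unfolding g_def by (rule continuous_on_compose2[OF cont Pc]) auto
  \<comment> \<open>A product of balls is compact by Tychonoff's theorem, so each component of the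
    truncated field is bounded; components beyond \<open>N\<close> vanish, so a finite sum gives a
    bound uniform in \<open>i\<close>.\<close>
  have "compact (PiE UNIV (\<lambda>_::nat. Q))"
    using Q(4) by (simp add: compactin_PiE flip: compactin_euclidean_iff euclidean_product_topology)
  then have "bounded ((\<lambda>x. f x i) ` PiE UNIV (\<lambda>_. Q))" for i
    by (intro compact_imp_bounded compact_continuous_image continuous_on_subset[OF cont]) auto
  then have "\<exists>b\<ge>0. \<forall>x\<in>PiE UNIV (\<lambda>_. Q). norm (f x i) \<le> b" for i
    by (metis (no_types, lifting) bounded_pos imageI less_imp_le)
  then obtain b where b: "\<And>i. b i \<ge> 0" "\<And>i x. x \<in> PiE UNIV (\<lambda>_. Q) \<Longrightarrow> norm (f x i) \<le> b i"
    by metis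
  have gbd: "norm (g x i) \<le> (\<Sum>i\<le>N. b i)" for x i
  proof (cases "i \<le> N")
    case True
    have "norm (g x i) \<le> b i" unfolding g_def using PQ by (intro b) auto
    also have "\<dots> \<le> (\<Sum>i\<le>N. b i)" using True b by (intro member_le_sum) auto
    finally show ?thesis .
  next
    case False
    then show ?thesis using supp(1) b(1) by (simp add: g_def sum_nonneg)
  qed
  obtain x where x0: "\<And>i. x i 0 = x0 i" and
    x: "\<And>i t. t \<ge> 0 \<Longrightarrow> (x i has_vector_derivative g (\<lambda>j. x j t) i) (at t within {0..})"
    using Peano_bounded[of g, OF gcont gbd] by blast
  \<comment> \<open>Components beyond \<open>N\<close> start at 0 and have zero derivative, hence
    never meet the truncation.\<close>
  have zero: "x i t = 0" if "i > N" "t \<ge> 0" for i t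
  proof -
    have "(x i has_vector_derivative 0) (at t within {0..})" if "t \<in> {0..}" for t
      using x[of t i] \<open>i > N\<close> supp(1) that unfolding g_def by simp
    then obtain c where "\<And>t. t \<in> {0..} \<Longrightarrow> x i t = c"
      using has_vector_derivative_zero_constant[of "{0..}" "x i"] by (metis convex_real_interval(1))
    then show ?thesis using that x0[of i] supp(2)[of i] by (metis atLeast_iff order_refl)
  qed
  have xc: "continuous_on {0..} (x i)" for i
    by (rule continuous_on_vector_derivative) (use x in auto)
  have truncation_inactive: "norm (x i t) \<le> R" if i: "i \<le> N" and T: "T \<ge> 0" "t \<in> {0..T}"
    and le: "\<And>i t. i \<le> N \<Longrightarrow> t \<in> {0..T} \<Longrightarrow> norm (x i t) \<le> R + 1" for i t T
  proof (rule apriori[of T x, OF T(1) x0 _ i T(2)])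
    fix i t assume t: "t \<in> {0..T}"
    have "norm (x j t) \<le> R + 1" for j
      using le[of j t] zero[of j t] t R by (cases "j \<le> N") auto
    then have "g (\<lambda>j. x j t) i = f (\<lambda>j. x j t) i" unfolding g_def by (simp add: Pid)
    then show "(x i has_vector_derivative f (\<lambda>j. x j t) i) (at t within {0..T})"
      using has_vector_derivative_within_subset[OF x[of t i], of "{0..T}"] t by auto
  qed
  have all: "norm (x i t) \<le> R + 1" if "i \<le> N" "t \<ge> 0" for i t
  proof (rule ccontr)
    assume neg: "\<not> ?thesis"
    \<comment> \<open>A finite union keeps this set of escape times closed, so there is a first one,
      \<open>T\<close>. Before \<open>T\<close> the bound is \<open>R\<close>, and continuity
      carries \<open>R\<close> over to \<open>T\<close> itself.\<close>
    define U where "U = (\<Union>i\<in>{..N}. {t\<in>{0..}. R + 1 \<le> norm (x i t)})"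
    have "closed U" unfolding U_def
      by (intro closed_UN continuous_closed_preimage_constant ballI continuous_on_closed_Collect_le 
            continuous_intros xc) auto
    moreover have "U \<noteq> {}" using neg that by (force simp: U_def)
    moreover have bb: "bdd_below U" by (rule bdd_belowI[of _ 0]) (auto simp: U_def)
    ultimately have inf: "Inf U \<in> U" using closed_contains_Inf by blast
    define T where "T = Inf U"
    obtain i0 where i0: "i0 \<le> N" "T \<ge> 0" "R + 1 \<le> norm (x i0 T)"
      using inf by (auto simp: U_def T_def)
    have T0: "T > 0" using i0 x0[of i0] R0[of i0] by (cases "T = 0") auto
    have before: "norm (x i s) \<le> R" if "0 \<le> s" "s < T" "i \<le> N" for i s
    proof (rule truncation_inactive[of i s s])
      fix i' t' assume "i' \<le> N" "t' \<in> {0..s}"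
      then show "norm (x i' t') \<le> R + 1"
        using that cInf_lower[OF _ bb, of t'] unfolding T_def U_def by fastforce
    qed (use that in auto)
    have "((\<lambda>s. norm (x i0 s)) \<longlongrightarrow> norm (x i0 T)) (at T within {0..})"
      using xc[of i0] i0(2) by (intro tendsto_norm) (auto simp: continuous_on)
    then have "((\<lambda>s. norm (x i0 s)) \<longlongrightarrow> norm (x i0 T)) (at T within {0..<T})"
      by (rule tendsto_within_subset) auto
    moreover have "at T within {0..<T} \<noteq> bot"
      using T0 by (simp add: trivial_limit_within islimpt_Ico) 
    ultimately have "norm (x i0 T) \<le> R"
      using before i0 by (intro tendsto_upperbound[of "\<lambda>s. norm (x i0 s)"]) (auto simp: eventually_at_filter)
    then show False using i0 by simp
  qed
  show thesis
  proof (rule that[of x])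
    show "x i 0 = x0 i" for i by (rule x0)
    fix i t assume t: "(t::real) \<ge> 0"
    have "norm (x j t) \<le> R + 1" for j
      using all[of j t] zero[of j t] t R by (cases "j \<le> N") auto
    then have "g (\<lambda>j. x j t) i = f (\<lambda>j. x j t) i" unfolding g_def by (simp add: Pid)
    then show "(x i has_vector_derivative f (\<lambda>j. x j t) i) (at t within {0..})"
      using x[OF t, of i] by simp
  qed
qed

section \<open>Barbalat's lemma and stable filters\<close>

text \<open>Mean value inequality with a moving majorant. Derivatives are taken within the closed
  interval, the form in which restricted trajectories provide them.\<close>

lemma norm_increment_le:
  fixes f :: "real \<Rightarrow> 'a::real_normed_vector"
  assumes "a \<le> b"
    and f': "\<And>s. s \<in> {a..b} \<Longrightarrow> (f has_vector_derivative f' s) (at s within {a..b})"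
    and p': "\<And>s. s \<in> {a..b} \<Longrightarrow> (p has_vector_derivative p' s) (at s within {a..b})"
    and bd: "\<And>s. s \<in> {a..b} \<Longrightarrow> norm (f' s) \<le> p' s"
  shows "norm (f b - f a) \<le> p b - p a"
proof (cases "a = b")
  case False
  with \<open>a \<le> b\<close> have "a < b" by simp
  then show ?thesis
  proof (rule differentiable_bound_general[where f'=f' and \<phi>'=p'])
    fix s assume s: "a < s" "s < b"
    then have "at s within {a..b} = at s" by (intro at_within_interior) auto
    then show "(f has_vector_derivative f' s) (at s)" "(p has_vector_derivative p' s) (at s)"
      using f'[of s] p'[of s] s by auto
    show "norm (f' s) \<le> p' s" using bd s by simp
  next
    show "continuous_on {a..b} f" "continuous_on {a..b} p"
      using continuous_on_vector_derivative f' p' by blast+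
  qed
qed simp

lemma norm_increment_le_linear:
  fixes f :: "real \<Rightarrow> 'a::real_normed_vector"
  assumes "a \<le> b"
    and "\<And>s. s \<in> {a..b} \<Longrightarrow> (f has_vector_derivative f' s) (at s within {a..b})"
    and "\<And>s. s \<in> {a..b} \<Longrightarrow> norm (f' s) \<le> B"
  shows "norm (f b - f a) \<le> B * (b - a)"
proof -
  have "norm (f b - f a) \<le> B * b - B * a"
    by (rule norm_increment_le[where f'=f' and p="\<lambda>s. B * s" and p'="\<lambda>_. B"])
      (use assms in \<open>auto intro!: derivative_eq_intros\<close>)
  then show ?thesis by (simp add: algebra_simps)
qed

lemma nonincreasing_of_derivative:
  fixes V :: "real \<Rightarrow> real"
  assumes "a \<le> b"
    and V': "\<And>s. s \<in> {a..b} \<Longrightarrow> (V has_vector_derivative V' s) (at s within {a..b})"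
    and nonpos: "\<And>s. s \<in> {a..b} \<Longrightarrow> V' s \<le> 0"
  shows "V b \<le> V a"
proof (cases "a = b")
  case False
  with \<open>a \<le> b\<close> have "a < b" by simp
  show ?thesis
  proof (rule DERIV_nonpos_imp_decreasing_open[OF \<open>a \<le> b\<close>])
    fix s assume s: "a < s" "s < b"
    then have "at s within {a..b} = at s" by (intro at_within_interior) auto
    then have "DERIV V s :> V' s"
      using V'[of s] s by (simp add: has_real_derivative_iff_has_vector_derivative)
    then show "\<exists>y. DERIV V s :> y \<and> y \<le> 0" using nonpos s by force
  next
    show "continuous_on {a..b} V" using continuous_on_vector_derivative V' by blast
  qed
qed simp

text \<open>Over a window of length \<open>h\<close> the increment of \<open>f\<close> is
  \<open>h *\<^sub>R g t\<close> up to an error of order \<open>h\<close> squared, because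
  \<open>g\<close> is Lipschitz. Increments of a convergent \<open>f\<close> vanish, so
  \<open>g t\<close> is eventually of order \<open>h\<close>, and \<open>h\<close> is
  arbitrary.\<close>

lemma Barbalat:
  fixes f g :: "real \<Rightarrow> 'a::real_normed_vector"
  assumes f': "\<And>t. t \<ge> 0 \<Longrightarrow> (f has_vector_derivative g t) (at t within {0..})"
    and g': "\<And>t. t \<ge> 0 \<Longrightarrow> (g has_vector_derivative g' t) (at t within {0..})"
    and bd: "\<And>t. t \<ge> 0 \<Longrightarrow> norm (g' t) \<le> L"
    and lim: "(f \<longlongrightarrow> l) at_top"
  shows "(g \<longlongrightarrow> 0) at_top"
proof -
  have L: "L \<ge> 0" using order_trans[OF norm_ge_zero bd[of 0]] by simp
  have remainder: "norm (f (t + h) - f t - h *\<^sub>R g t) \<le> L * h * h" if t: "t \<ge> 0" and h: "h \<ge> 0" for t h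
  proof -
    have sub: "{t..b} \<subseteq> {0..}" for b using t by auto
    have lip: "norm (g s - g t) \<le> L * (s - t)" if "t \<le> s" for s
      by (rule norm_increment_le_linear[where f'=g'])
        (use that t bd sub in \<open>auto intro!: has_vector_derivative_within_subset[OF g']\<close>)
    have "norm ((f (t + h) - (t + h) *\<^sub>R g t) - (f t - t *\<^sub>R g t)) \<le> L * h * (t + h - t)"
    proof (rule norm_increment_le_linear[where f'="\<lambda>s. g s - g t"])
      fix s assume s: "s \<in> {t..t + h}"
      have "(f has_vector_derivative g s) (at s within {t..t + h})"
        using f'[of s] s t sub by (auto intro: has_vector_derivative_within_subset)
      then show "((\<lambda>s. f s - s *\<^sub>R g t) has_vector_derivative g s - g t) (at s within {t..t + h})"
        by (auto intro!: derivative_eq_intros)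
      have "norm (g s - g t) \<le> L * (s - t)" using lip s by simp
      also have "\<dots> \<le> L * h" using s L by (intro mult_left_mono) auto
      finally show "norm (g s - g t) \<le> L * h" .
    qed (use h in simp)
    then show ?thesis by (simp add: algebra_simps)
  qed
  show ?thesis
  proof (rule tendstoI)
    fix e :: real assume e: "e > 0"
    \<comment> \<open>With this \<open>h\<close> the remainder \<open>L * h * h\<close> takes at
      most half of the budget \<open>h * e\<close>; the added 1 covers \<open>L = 0\<close>.\<close>
    define h where "h = e / (2 * (L + 1))"
    have h: "h > 0" using e L by (simp add: h_def)
    have "filterlim (\<lambda>t. t + h) at_top at_top"
      using filterlim_tendsto_add_at_top[OF tendsto_const filterlim_ident, of h] by (simp add: add.commute)
    then have "((\<lambda>t. f (t + h)) \<longlongrightarrow> l) at_top" by (rule filterlim_compose[OF lim])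
    from tendsto_norm[OF tendsto_diff[OF this lim]]
    have "((\<lambda>t. norm (f (t + h) - f t)) \<longlongrightarrow> 0) at_top" by simp
    then have "eventually (\<lambda>t. norm (f (t + h) - f t) < h * (e / 2)) at_top"
      using e h by (intro order_tendstoD) auto
    then show "eventually (\<lambda>t. dist (g t) 0 < e) at_top"
      using eventually_ge_at_top[of 0]
    proof eventually_elim
      case (elim t)
      have "h * norm (g t) = norm (h *\<^sub>R g t)" using h by simp
      also have "\<dots> \<le> norm (f (t + h) - f t) + norm (f (t + h) - f t - h *\<^sub>R g t)"
        by (metis add_diff_cancel_left' diff_diff_eq2 norm_triangle_ineq4)
      also have "\<dots> < h * (e / 2) + L * h * h" using elim remainder[of t h] h by auto
      also have "\<dots> \<le> h * (e / 2) + (L + 1) * h * h" using h by (simp add: algebra_simps)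
      also have "\<dots> = h * e"
      proof -
        have "2 * L + 2 \<noteq> 0" using L by linarith
        then have "(L + 1) * h = e / 2" by (simp add: h_def field_simps)
        then show ?thesis by (simp only:) simp
      qed
      finally show ?case using h by simp
    qed
  qed
qed

lemma nonincreasing_bounded_below_convergent:
  fixes V :: "real \<Rightarrow> real"
  assumes mono: "\<And>s t. 0 \<le> s \<Longrightarrow> s \<le> t \<Longrightarrow> V t \<le> V s" and pos: "\<And>t. t \<ge> 0 \<Longrightarrow> V t \<ge> 0"
  shows "\<exists>l. (V \<longlongrightarrow> l) at_top"
proof
  have bb: "bdd_below (V ` {0..})" using pos by (intro bdd_belowI2) auto
  show "(V \<longlongrightarrow> Inf (V ` {0..})) at_top"
  proof (rule order_tendstoI)
    fix a assume "a < Inf (V ` {0..})"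
    then show "eventually (\<lambda>t. a < V t) at_top"
      by (intro eventually_at_top_linorderI[of 0]) (auto intro: less_le_trans cInf_lower[OF _ bb])
  next
    fix a assume "Inf (V ` {0..}) < a"
    then obtain s where "s \<ge> 0" "V s < a"
      using cInf_less_iff[OF _ bb] by auto
    then show "eventually (\<lambda>t. V t < a) at_top"
      by (intro eventually_at_top_linorderI[of s]) (auto intro: le_less_trans[OF mono])
  qed
qed

text \<open>The Lyapunov function may have a nonzero limit; it merely converges, being monotone and
  nonnegative, and Barbalat's lemma turns this into a vanishing dissipation rate.\<close>

lemma Lyapunov_Barbalat:
  fixes V g :: "real \<Rightarrow> real"
  assumes V': "\<And>t. t \<ge> 0 \<Longrightarrow> (V has_vector_derivative - g t) (at t within {0..})"
    and g': "\<And>t. t \<ge> 0 \<Longrightarrow> (g has_vector_derivative g' t) (at t within {0..})"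
    and bd: "\<And>t. t \<ge> 0 \<Longrightarrow> \<bar>g' t\<bar> \<le> L"
    and pos: "\<And>t. t \<ge> 0 \<Longrightarrow> V t \<ge> 0" "\<And>t. t \<ge> 0 \<Longrightarrow> g t \<ge> 0"
  shows "(g \<longlongrightarrow> 0) at_top"
proof -
  have "V t \<le> V s" if st: "0 \<le> s" "s \<le> t" for s t
  proof (rule nonincreasing_of_derivative[where V'="\<lambda>t. - g t", OF st(2)])
    fix r assume "r \<in> {s..t}"
    with st show "(V has_vector_derivative - g r) (at r within {s..t})" "- g r \<le> 0"
      using has_vector_derivative_within_subset[OF V'[of r], of "{s..t}"] pos(2)[of r] by auto
  qed
  then obtain l where l: "(V \<longlongrightarrow> l) at_top"
    using nonincreasing_bounded_below_convergent pos(1) by blast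
  have "((\<lambda>t. - g t) \<longlongrightarrow> 0) at_top"
  proof (rule Barbalat[OF V' _ _ l])
    show "((\<lambda>t. - g t) has_vector_derivative - g' t) (at t within {0..})" if "t \<ge> 0" for t
      using g'[OF that] by (rule has_vector_derivative_minus)
    show "norm (- g' t) \<le> L" if "t \<ge> 0" for t using bd[OF that] by simp
  qed
  from tendsto_minus[OF this] show ?thesis by simp
qed

text \<open>The integrating factor \<open>exp (\<alpha> * (s - a))\<close> removes the linear term,
  and the remaining derivative is at most \<open>U\<close> times that factor, whose primitive
  carries \<open>U / \<alpha>\<close>. The start \<open>a\<close> is free so that the estimate can
  be restarted late.\<close>

lemma stable_filter_bound:
  fixes z :: "real \<Rightarrow> 'a::real_normed_vector"
  assumes "a \<le> b" "\<alpha> > 0"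
    and z': "\<And>s. s \<in> {a..b} \<Longrightarrow> (z has_vector_derivative u s - \<alpha> *\<^sub>R z s) (at s within {a..b})"
    and bd: "\<And>s. s \<in> {a..b} \<Longrightarrow> norm (u s) \<le> U"
  shows "norm (z b) \<le> exp (- \<alpha> * (b - a)) * norm (z a) + U / \<alpha>"
proof -
  let ?E = "\<lambda>s. exp (\<alpha> * (s - a))"
  have U: "U \<ge> 0" using order_trans[OF norm_ge_zero bd[of a]] \<open>a \<le> b\<close> by simp
  have "norm (?E b *\<^sub>R z b - ?E a *\<^sub>R z a) \<le> U / \<alpha> * ?E b - U / \<alpha> * ?E a"
  proof (rule norm_increment_le[where f'="\<lambda>s. ?E s *\<^sub>R u s" and p'="\<lambda>s. U * ?E s"])
    fix s assume s: "s \<in> {a..b}"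
    have E': "(?E has_vector_derivative \<alpha> * ?E s) (at s within {a..b})"
      by (auto intro!: derivative_eq_intros simp flip: has_real_derivative_iff_has_vector_derivative)
    show "((\<lambda>s. ?E s *\<^sub>R z s) has_vector_derivative ?E s *\<^sub>R u s) (at s within {a..b})"
    proof -
      have "((\<lambda>s. ?E s *\<^sub>R z s) has_vector_derivative
          ?E s *\<^sub>R (u s - \<alpha> *\<^sub>R z s) + (\<alpha> * ?E s) *\<^sub>R z s) (at s within {a..b})"
        using E' z'[OF s]
        by (intro has_vector_derivative_scaleR) (simp_all add: has_real_derivative_iff_has_vector_derivative)
      then show ?thesis by (simp add: algebra_simps)
    qed
    show "((\<lambda>s. U / \<alpha> * ?E s) has_vector_derivative U * ?E s) (at s within {a..b})"
      using has_vector_derivative_mult_right[OF E', of "U / \<alpha>"] \<open>\<alpha> > 0\<close> by simp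
    show "norm (?E s *\<^sub>R u s) \<le> U * ?E s" using bd[OF s] by simp
  qed (rule \<open>a \<le> b\<close>)
  then have "norm (?E b *\<^sub>R z b) \<le> norm (z a) + (U / \<alpha> * ?E b - U / \<alpha>)"
    using norm_triangle_sub[of "?E b *\<^sub>R z b" "z a"] by simp
  also have "\<dots> \<le> norm (z a) + U / \<alpha> * ?E b" using U \<open>\<alpha> > 0\<close> by simp
  finally have "?E b * norm (z b) \<le> norm (z a) + U / \<alpha> * ?E b" by simp
  then have "norm (z b) \<le> (norm (z a) + U / \<alpha> * ?E b) / ?E b"
    by (simp add: pos_le_divide_eq mult.commute)
  also have "\<dots> = exp (- \<alpha> * (b - a)) * norm (z a) + U / \<alpha>"
    by (simp add: add_divide_distrib exp_minus) (simp add: divide_inverse)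
  finally show ?thesis .
qed

lemma stable_filter_tendsto:
  fixes z :: "real \<Rightarrow> 'a::real_normed_vector"
  assumes "\<alpha> > 0"
    and z': "\<And>t. t \<ge> 0 \<Longrightarrow> (z has_vector_derivative u t - \<alpha> *\<^sub>R z t) (at t within {0..})"
    and u: "(u \<longlongrightarrow> 0) at_top"
  shows "(z \<longlongrightarrow> 0) at_top"
proof (rule tendstoI)
  fix e :: real assume e: "e > 0"
  have "eventually (\<lambda>t. norm (u t) < e / 2 * \<alpha>) at_top"
    by (rule order_tendstoD(2)[OF tendsto_norm[OF u]]) (use e \<open>\<alpha> > 0\<close> in simp)
  then obtain t0 where t0: "\<And>t. t \<ge> t0 \<Longrightarrow> norm (u t) < e / 2 * \<alpha>"
    by (auto simp: eventually_at_top_linorder)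
  \<comment> \<open>From \<open>a\<close> on the input contributes at most \<open>e / 2\<close>,
    while the memory of \<open>z a\<close> decays exponentially. The maximum with 0 keeps
    \<open>a\<close> where the filter equation is assumed.\<close>
  define a where "a = max t0 0"
  have bound: "norm (z t) \<le> exp (- \<alpha> * (t - a)) * norm (z a) + e / 2" if "t \<ge> a" for t
  proof -
    have "norm (z t) \<le> exp (- \<alpha> * (t - a)) * norm (z a) + (e / 2 * \<alpha>) / \<alpha>"
      by (rule stable_filter_bound[where u=u, OF that \<open>\<alpha> > 0\<close>])
        (use t0 in \<open>auto simp: a_def less_imp_le intro!: has_vector_derivative_within_subset[OF z']\<close>)
    then show ?thesis using \<open>\<alpha> > 0\<close> by simp
  qed
  have "filterlim (\<lambda>t. \<alpha> * (t + (- a))) at_top at_top"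
    by (intro filterlim_tendsto_pos_mult_at_top[OF tendsto_const \<open>\<alpha> > 0\<close>]
        filterlim_at_top_add_at_top filterlim_tendsto_add_at_top[OF tendsto_const filterlim_ident, of "-a", unfolded add.commute[of "-a"]])
  then have "((\<lambda>t. exp (- (\<alpha> * (t + (- a))))) \<longlongrightarrow> 0) at_top"
    by (rule filterlim_compose[OF exp_at_bot filterlim_compose[OF filterlim_uminus_at_bot_at_top]])
  from tendsto_mult_left_zero[OF this, of "norm (z a)"]
  have "eventually (\<lambda>t. exp (- \<alpha> * (t - a)) * norm (z a) < e / 2) at_top"
    using e by (intro order_tendstoD) auto
  then show "eventually (\<lambda>t. dist (z t) 0 < e) at_top"
    using eventually_ge_at_top[of a]
  proof eventually_elim
    case (elim t)
    then show ?case using bound[of t] by simp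
  qed
qed

section \<open>Bilinear maps and bounded trajectories\<close>

lemma bounded_bilinear_matrix_vector_mult:
  "bounded_bilinear ((*v) :: real^'n^'m \<Rightarrow> real^'n \<Rightarrow> real^'m)"
  unfolding bilinear_conv_bounded_bilinear[symmetric] bilinear_def
  by (auto intro!: linearI simp: algebra_simps scaleR_matrix_vector_assoc matrix_vector_mult_add_rdistrib
       matrix_vector_right_distrib matrix_vector_mult_scaleR)

lemma bounded_image_bilinear:
  assumes "bounded_bilinear bil" "bounded (f ` S)" "bounded (g ` S)"
  shows "bounded ((\<lambda>x. bil (f x) (g x)) ` S)"
proof -
  interpret bounded_bilinear bil by fact
  obtain K where K: "K > 0" "\<And>a b. norm (bil a b) \<le> norm a * norm b * K"
    using pos_bounded by blast
  obtain A B where A: "A > 0" "\<And>x. x \<in> S \<Longrightarrow> norm (f x) \<le> A"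
    and B: "B > 0" "\<And>x. x \<in> S \<Longrightarrow> norm (g x) \<le> B"
    using assms(2,3) by (auto simp: bounded_pos)
  have "norm (bil (f x) (g x)) \<le> A * B * K" if "x \<in> S" for x
  proof -
    have "norm (bil (f x) (g x)) \<le> norm (f x) * norm (g x) * K" by (rule K)
    also have "\<dots> \<le> A * B * K"
      using A B K that by (intro mult_mono) auto
    finally show ?thesis .
  qed
  then show ?thesis by (auto simp: bounded_iff)
qed

lemma bounded_image_sum:
  fixes f :: "'i \<Rightarrow> 'b \<Rightarrow> 'a::real_normed_vector"
  assumes "\<And>i. i \<in> I \<Longrightarrow> bounded (f i ` S)"
  shows "bounded ((\<lambda>x. \<Sum>i\<in>I. f i x) ` S)"
  using assms
proof (induction I rule: infinite_finite_induct)
  case (insert i I)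
  then show ?case by (auto intro!: bounded_plus_comp)
qed (auto simp: image_constant_conv)

lemma bounded_image_const: "bounded ((\<lambda>x. c) ` S)"
  by (simp add: image_constant_conv)

section \<open>The grounded Laplacian\<close>

lemma sum_UNIV_half: "(\<Sum>c\<in>UNIV. f c) = (\<Sum>k\<in>UNIV. f (k, H1) + f (k, H2))"
  for f :: "'l::finite \<times> half \<Rightarrow> 'b::comm_monoid_add"
proof -
  have "(\<Sum>c\<in>UNIV. f c) = (\<Sum>(k, h)\<in>UNIV \<times> UNIV. f (k, h))" by simp
  also have "\<dots> = (\<Sum>k\<in>UNIV. \<Sum>h\<in>UNIV. f (k, h))" by (rule sum.cartesian_product[symmetric])
  finally show ?thesis by (simp add: UNIV_half)
qed

lemma Smat_mult_component [simp]:
  "(Smat z *v x) $ (k, H1) = z $ k * x $ (k, H2)"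
  "(Smat z *v x) $ (k, H2) = - (z $ k * x $ (k, H1))"
proof -
  have "(Smat z *v x) $ (k, H1) = (\<Sum>i\<in>UNIV. if i = k then z $ k * x $ (k, H2) else 0)"
    "(Smat z *v x) $ (k, H2) = (\<Sum>i\<in>UNIV. if i = k then - (z $ k * x $ (k, H1)) else 0)"
    unfolding Smat_def kron_def diagm_def amat_def matrix_vector_mult_def sum_UNIV_half vec_lambda_beta
    by (auto intro!: sum.cong simp del: sum.delta sum.delta')
  then show "(Smat z *v x) $ (k, H1) = z $ k * x $ (k, H2)"
    "(Smat z *v x) $ (k, H2) = - (z $ k * x $ (k, H1))" by simp_all
qed

lemma phi_mult_component [simp]:
  "(phi e *v x) $ k = e $ (k, H1) * x $ (k, H2) - e $ (k, H2) * x $ (k, H1)"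
proof -
  have "(phi e *v x) $ k = (\<Sum>i\<in>UNIV. if i = k then e $ (k, H1) * x $ (k, H2) - e $ (k, H2) * x $ (k, H1) else 0)"
    unfolding phi_def matrix_vector_mult_def sum_UNIV_half vec_lambda_beta
    by (intro sum.cong) auto
  then show ?thesis by simp
qed

lemma half_vec_eqI:
  fixes x y :: "real^('l::finite \<times> half)"
  assumes "\<And>k. x $ (k, H1) = y $ (k, H1)" "\<And>k. x $ (k, H2) = y $ (k, H2)"
  shows "x = y"
proof -
  have "x $ (k, h) = y $ (k, h)" for k h
    using assms by (cases h) simp_all
  then show ?thesis unfolding vec_eq_iff by simp
qed

lemma inner_half: "x \<bullet> y = (\<Sum>k\<in>UNIV. x $ (k, H1) * y $ (k, H1) + x $ (k, H2) * y $ (k, H2))"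
  for x y :: "real^('l::finite \<times> half)"
  by (simp add: inner_vec_def sum_UNIV_half)

lemma bounded_bilinear_Smat: "bounded_bilinear (\<lambda>z x. Smat z *v (x :: real^('l::finite \<times> half)))"
  unfolding bilinear_conv_bounded_bilinear[symmetric] bilinear_def
  by (auto intro!: linearI half_vec_eqI simp: algebra_simps)

lemma bounded_bilinear_phi: "bounded_bilinear (\<lambda>e x. phi e *v (x :: real^('l::finite \<times> half)))"
  unfolding bilinear_conv_bounded_bilinear[symmetric] bilinear_def
  by (auto intro!: linearI simp: vec_eq_iff algebra_simps)

text \<open>For fixed \<open>x\<close> and \<open>e\<close> the left side is linear in
  \<open>z\<close>, and \<open>phi e *v x\<close> is its gradient. This is the origin of the matrix
  \<open>phi\<close>: it makes the frequency update the gradient law that absorbs the frequency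
  error.\<close>

lemma Smat_inner_eq_phi: "(Smat z *v x) \<bullet> e = z \<bullet> (phi e *v x)"
  unfolding inner_half inner_vec_def by (intro sum.cong) (auto simp: algebra_simps)

lemma Smat_skew: "(Smat z *v x) \<bullet> y = - (x \<bullet> (Smat z *v y))"
  unfolding inner_half sum_negf[symmetric] by (intro sum.cong) (auto simp: algebra_simps)

lemma Smat_diff_mult: "Smat (z - z') *v x = Smat z *v x - Smat z' *v x"
  by (intro half_vec_eqI) (auto simp: algebra_simps)

section \<open>Disagreement and the Dirichlet form of the graph\<close>

definition disagreement :: "nat \<Rightarrow> (nat \<Rightarrow> nat \<Rightarrow> bool) \<Rightarrow> (nat \<Rightarrow> 'a::real_vector) \<Rightarrow> nat \<Rightarrow> 'a" where
  "disagreement N E x i = (\<Sum>j\<in>nbrs N E i. x j - x i)"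

lemma finite_nbrs [simp]: "finite (nbrs N E i)"
  by (simp add: nbrs_def)

text \<open>Differences ignore a common shift, so the signal computed from the estimates is also the
  disagreement of the errors, whose leader entry is 0.\<close>

lemma disagreement_shift: "disagreement N E (\<lambda>j. x j - a) i = disagreement N E x i"
  by (simp add: disagreement_def)

locale leader_follower_graph =
  fixes N :: nat and E :: "nat \<Rightarrow> nat \<Rightarrow> bool"
  assumes tree: "has_spanning_tree_rooted {0..N} E 0"
    and undirected: "\<And>i j. i \<in> {1..N} \<Longrightarrow> j \<in> {1..N} \<Longrightarrow> E j i \<longleftrightarrow> E i j"
begin

text \<open>The bilinear form of the grounded Laplacian, written edge by edge so that symmetry and
  nonnegativity are visible. Each follower edge occurs in both directions, hence the half; an edge
  from the leader pins its node to 0.\<close>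

definition energy :: "(nat \<Rightarrow> 'a::real_inner) \<Rightarrow> (nat \<Rightarrow> 'a) \<Rightarrow> real" where
  "energy x y = (\<Sum>i=1..N. of_bool (E 0 i) * (x i \<bullet> y i))
     + (\<Sum>i=1..N. \<Sum>j=1..N. of_bool (E j i) * ((x i - x j) \<bullet> (y i - y j))) / 2"

lemma energy_commute: "energy x y = energy y x"
  by (simp add: energy_def inner_commute)

text \<open>Summation by parts on the graph. In this polarised form it applies with the error in one
  slot and its rate in the other.\<close>

lemma energy_eq_disagreement:
  assumes "y 0 = 0"
  shows "energy x y = - (\<Sum>i=1..N. x i \<bullet> disagreement N E y i)"
proof -
  have dis: "disagreement N E y i = (\<Sum>j=1..N. of_bool (E j i) *\<^sub>R (y j - y i)) - of_bool (E 0 i) *\<^sub>R y i" for i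
  proof -
    have "disagreement N E y i = (\<Sum>j\<in>{0..N}. if E j i then y j - y i else 0)"
      unfolding disagreement_def nbrs_def by (rule sum.inter_filter) simp
    also have "\<dots> = (\<Sum>j\<in>{0..N}. of_bool (E j i) *\<^sub>R (y j - y i))"
      by (intro sum.cong) auto
    also have "\<dots> = of_bool (E 0 i) *\<^sub>R (y 0 - y i) + (\<Sum>j=1..N. of_bool (E j i) *\<^sub>R (y j - y i))"
      by (subst sum.atLeast_Suc_atMost) auto
    finally show ?thesis using assms by simp
  qed
  let ?A = "\<lambda>u w. (\<Sum>i=1..N. \<Sum>j=1..N. of_bool (E j i) * (u i j \<bullet> w i j)) :: real"
  \<comment> \<open>Exchanging the names \<open>i\<close> and \<open>j\<close> reverses every edge;
    undirectedness restores the edge set, and only the sign of \<open>y i - y j\<close>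
    changes.\<close>
  have swap: "?A (\<lambda>i j. x j) (\<lambda>i j. y i - y j) = - ?A (\<lambda>i j. x i) (\<lambda>i j. y i - y j)"
  proof -
    have "?A (\<lambda>i j. x j) (\<lambda>i j. y i - y j) = (\<Sum>j=1..N. \<Sum>i=1..N. of_bool (E j i) * (x j \<bullet> (y i - y j)))"
      by (rule sum.swap)
    also have "\<dots> = (\<Sum>i=1..N. \<Sum>j=1..N. - (of_bool (E j i) * (x i \<bullet> (y i - y j))))"
      using undirected by (intro sum.cong) (auto simp: inner_diff_right)
    finally show ?thesis by (simp add: sum_negf)
  qed
  have "?A (\<lambda>i j. x i - x j) (\<lambda>i j. y i - y j)
      = ?A (\<lambda>i j. x i) (\<lambda>i j. y i - y j) - ?A (\<lambda>i j. x j) (\<lambda>i j. y i - y j)"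
    by (simp add: inner_diff_left right_diff_distrib sum_subtractf)
  then have "energy x y = (\<Sum>i=1..N. of_bool (E 0 i) * (x i \<bullet> y i)) + ?A (\<lambda>i j. x i) (\<lambda>i j. y i - y j)"
    unfolding energy_def swap by simp
  also have "\<dots> = (\<Sum>i=1..N. of_bool (E 0 i) * (x i \<bullet> y i) + (\<Sum>j=1..N. of_bool (E j i) * (x i \<bullet> (y i - y j))))"
    by (simp add: sum.distrib)
  also have "\<dots> = (\<Sum>i=1..N. - (x i \<bullet> disagreement N E y i))"
    unfolding dis
    by (intro sum.cong refl)
      (simp add: inner_diff_right inner_sum_right sum_subtractf right_diff_distrib)
  finally show ?thesis by (simp add: sum_negf)
qed

lemma energy_nonneg: "0 \<le> energy x x"
  unfolding energy_def by (intro add_nonneg_nonneg sum_nonneg divide_nonneg_nonneg) auto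

text \<open>All edge terms are nonnegative, so a single one is at most the whole sum; the 2 undoes
  the half in front of the follower edges.\<close>

lemma energy_edge_bound:
  assumes "x 0 = 0" "i \<in> {1..N}" "j \<in> {0..N}" "E j i"
  shows "norm (x i - x j) \<le> sqrt (2 * energy x x)"
proof -
  let ?l = "\<lambda>i. of_bool (E 0 i) * (x i \<bullet> x i)"
  let ?f = "\<lambda>i j. of_bool (E j i) * ((x i - x j) \<bullet> (x i - x j))"
  have "(norm (x i - x j))\<^sup>2 \<le> 2 * energy x x"
  proof (cases "j = 0")
    case True
    have "?l i \<le> (\<Sum>i=1..N. ?l i)"
      using assms by (intro member_le_sum) auto
    moreover have "0 \<le> (\<Sum>i=1..N. \<Sum>j=1..N. ?f i j)" by (intro sum_nonneg) auto
    moreover have "0 \<le> ?l i" by auto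
    ultimately have "x i \<bullet> x i \<le> energy x x" "0 \<le> x i \<bullet> x i" using assms True by (auto simp: energy_def)
    then have "x i \<bullet> x i \<le> 2 * energy x x" by linarith
    then show ?thesis using True assms by (simp add: power2_norm_eq_inner)
  next
    case False
    have "?f i j \<le> (\<Sum>j=1..N. ?f i j)"
      using assms False by (intro member_le_sum) auto
    also have "\<dots> \<le> (\<Sum>i=1..N. \<Sum>j=1..N. ?f i j)"
      using assms by (intro member_le_sum[where f="\<lambda>i. \<Sum>j=1..N. ?f i j"] sum_nonneg) auto
    also have "\<dots> \<le> 2 * energy x x"
      unfolding energy_def by (auto intro!: sum_nonneg)
    finally show ?thesis using assms(4) by (simp add: power2_norm_eq_inner)
  qed
  then show ?thesis by (rule real_le_rsqrt)
qed

text \<open>Positive definiteness of the grounded Laplacian, obtained by walking down the tree from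
  the leader, where \<open>x\<close> vanishes: each tree edge costs one more multiple of the square
  root.\<close>

lemma energy_coercive:
  obtains c where "c \<ge> 0" "\<And>(x :: nat \<Rightarrow> 'a::real_inner) i. x 0 = 0 \<Longrightarrow> i \<le> N \<Longrightarrow> norm (x i) \<le> c * sqrt (2 * energy x x)"
proof -
  obtain T where T: "\<And>x y. T x y \<Longrightarrow> E x y \<and> x \<in> {0..N} \<and> y \<in> {0..N}" "\<And>x. \<not> T x 0"
    "\<And>y. y \<in> {0..N} \<Longrightarrow> (0, y) \<in> {(x, y). T x y}\<^sup>*"
    using tree unfolding has_spanning_tree_rooted_def by blast
  have "\<exists>c\<ge>0. \<forall>x :: nat \<Rightarrow> 'a. x 0 = 0 \<longrightarrow> norm (x i) \<le> c * sqrt (2 * energy x x)" if "(0, i) \<in> {(x, y). T x y}\<^sup>*" for i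
    using that
  proof (induction rule: rtrancl_induct)
    case base
    show ?case by (intro exI[of _ 0]) auto
  next
    case (step j i)
    then obtain c where c: "c \<ge> 0" "\<And>x :: nat \<Rightarrow> 'a. x 0 = 0 \<Longrightarrow> norm (x j) \<le> c * sqrt (2 * energy x x)" by blast
    \<comment> \<open>The root has no parent in \<open>T\<close>, so the head \<open>i\<close> of a
      tree edge is a follower.\<close>
    have edge: "E j i" "j \<in> {0..N}" "i \<in> {1..N}"
      using T(1)[of j i] T(2) step.hyps(2) by (auto simp: Suc_le_eq intro!: gr0I)
    show ?case
    proof (intro exI[of _ "c + 1"] conjI allI impI)
      fix x :: "nat \<Rightarrow> 'a" assume x: "x 0 = 0"
      have "norm (x i) \<le> norm (x j) + norm (x i - x j)" by (rule norm_triangle_sub)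
      also have "\<dots> \<le> c * sqrt (2 * energy x x) + sqrt (2 * energy x x)"
        using c(2)[of x] energy_edge_bound[of x i j] x edge by (intro add_mono) auto
      finally show "norm (x i) \<le> (c + 1) * sqrt (2 * energy x x)" by (simp add: algebra_simps)
    qed (use c in simp)
  qed
  then have "\<exists>c\<ge>0. \<forall>x :: nat \<Rightarrow> 'a. x 0 = 0 \<longrightarrow> norm (x i) \<le> c * sqrt (2 * energy x x)" if "i \<le> N" for i
    using T(3) that by simp
  then obtain c where c: "\<And>i. i \<le> N \<Longrightarrow> c i \<ge> 0"
    "\<And>i (x :: nat \<Rightarrow> 'a). i \<le> N \<Longrightarrow> x 0 = 0 \<Longrightarrow> norm (x i) \<le> c i * sqrt (2 * energy x x)"
    by metis
  show thesis
  proof (rule that[of "\<Sum>i\<le>N. c i"])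
    show "0 \<le> (\<Sum>i\<le>N. c i)" using c(1) by (intro sum_nonneg) auto
    fix x :: "nat \<Rightarrow> 'a" and i assume x: "x 0 = 0" "i \<le> N"
    have "norm (x i) \<le> c i * sqrt (2 * energy x x)" using c x by blast
    also have "\<dots> \<le> (\<Sum>i\<le>N. c i) * sqrt (2 * energy x x)"
      using c(1) x energy_nonneg[of x] by (intro mult_right_mono member_le_sum) auto
    finally show "norm (x i) \<le> (\<Sum>i\<le>N. c i) * sqrt (2 * energy x x)" .
  qed
qed

lemma energy_has_vector_derivative:
  assumes "\<And>i. i \<in> {1..N} \<Longrightarrow> (X i has_vector_derivative X' i) (at t within J)"
  shows "((\<lambda>t. energy (\<lambda>i. X i t) (\<lambda>i. X i t)) has_vector_derivative 2 * energy X' (\<lambda>i. X i t)) (at t within J)"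
proof -
  have "((\<lambda>t. energy (\<lambda>i. X i t) (\<lambda>i. X i t)) has_vector_derivative
      energy (\<lambda>i. X i t) X' + energy X' (\<lambda>i. X i t)) (at t within J)"
  proof -
    have sq: "((\<lambda>t. x t \<bullet> x t) has_vector_derivative x t \<bullet> x' + x' \<bullet> x t) (at t within J)"
      if "(x has_vector_derivative x') (at t within J)" for x :: "real \<Rightarrow> 'a" and x'
      by (rule bounded_bilinear.has_vector_derivative[OF bounded_bilinear_inner that that])
    have "((\<lambda>t. energy (\<lambda>i. X i t) (\<lambda>i. X i t)) has_vector_derivative
      (\<Sum>i=1..N. of_bool (E 0 i) * (X i t \<bullet> X' i + X' i \<bullet> X i t)) +
      (\<Sum>i=1..N. \<Sum>j=1..N. of_bool (E j i) *
        ((X i t - X j t) \<bullet> (X' i - X' j) + (X' i - X' j) \<bullet> (X i t - X j t))) / 2) (at t within J)"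
      unfolding energy_def
      by (intro has_vector_derivative_add has_vector_derivative_sum has_vector_derivative_mult_right
          has_vector_derivative_divide sq has_vector_derivative_diff assms) 
    then show ?thesis
      by (simp only: energy_def distrib_left sum.distrib add_divide_distrib ac_simps)
  qed
  then show ?thesis by (simp add: energy_commute[of X'])
qed

end

section \<open>The adaptive distributed observer\<close>

locale observer_network = leader_follower_graph +
  fixes mu1 mu2 :: real and om0 :: "real^'l::finite"
  assumes mu1_pos: "mu1 > 0" and mu2_pos: "mu2 > 0"
begin

text \<open>Node 0 runs the leader with the true \<open>om0\<close>, which turns leader and
  observers into one network; a follower's rate contains its own \<open>w i\<close> instead.\<close>

definition eta_rate :: "(nat \<Rightarrow> real^('l \<times> half)) \<Rightarrow> (nat \<Rightarrow> real^'l) \<Rightarrow> nat \<Rightarrow> real^('l \<times> half)" where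
  "eta_rate h w i = (if i = 0 then Smat om0 *v h 0 else Smat (w i) *v h i + mu1 *\<^sub>R disagreement N E h i)"

definition om_rate :: "(nat \<Rightarrow> real^('l \<times> half)) \<Rightarrow> nat \<Rightarrow> real^'l" where
  "om_rate h i = mu2 *\<^sub>R (phi (disagreement N E h i) *v h i)"

text \<open>The set \<open>J\<close> of times is left open: \<open>{0..T}\<close> serves the a
  priori bounds, \<open>{0..}\<close> the limits.\<close>

definition observer_on :: "real set \<Rightarrow> (nat \<Rightarrow> real \<Rightarrow> real^('l \<times> half)) \<Rightarrow> (nat \<Rightarrow> real \<Rightarrow> real^'l) \<Rightarrow> bool" where
  "observer_on J h w \<longleftrightarrow> (\<forall>t\<in>J.
     (\<forall>i\<le>N. (h i has_vector_derivative eta_rate (\<lambda>j. h j t) (\<lambda>j. w j t) i) (at t within J)) \<and>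
     (\<forall>i\<in>{1..N}. (w i has_vector_derivative om_rate (\<lambda>j. h j t) i) (at t within J)))"

definition observer_lyap :: "(nat \<Rightarrow> real^('l \<times> half)) \<Rightarrow> (nat \<Rightarrow> real^'l) \<Rightarrow> real" where
  "observer_lyap h w = energy (\<lambda>i. h i - h 0) (\<lambda>i. h i - h 0) / 2
     + (\<Sum>i=1..N. (w i - om0) \<bullet> (w i - om0)) / (2 * mu2)"

lemma observer_on_subset: "observer_on J h w \<Longrightarrow> I \<subseteq> J \<Longrightarrow> observer_on I h w"
  unfolding observer_on_def by (meson has_vector_derivative_within_subset subsetD)

text \<open>Skewness moves \<open>Smat z\<close> across each edge term with a sign, and symmetry of
  \<open>energy\<close> brings it back, so the value equals its own negative.\<close>

lemma energy_Smat: "energy (\<lambda>i. Smat z *v x i) x = 0"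
proof -
  have "energy (\<lambda>i. Smat z *v x i) x = - energy x (\<lambda>i. Smat z *v x i)"
    unfolding energy_def matrix_vector_mult_diff_distrib[symmetric] Smat_skew
    by (simp add: sum_negf)
  then show ?thesis by (simp add: energy_commute[of x])
qed

lemma observer_lyap_derivative:
  assumes obs: "observer_on J h w" and t: "t \<in> J"
  shows "((\<lambda>t. observer_lyap (\<lambda>i. h i t) (\<lambda>i. w i t)) has_vector_derivative
    - (mu1 * (\<Sum>i=1..N. (norm (disagreement N E (\<lambda>j. h j t) i))\<^sup>2))) (at t within J)"
proof -
  let ?h = "\<lambda>j. h j t" and ?w = "\<lambda>j. w j t"
  let ?x = "\<lambda>i. h i t - h 0 t" and ?e = "disagreement N E ?h"
  let ?x' = "\<lambda>i. eta_rate ?h ?w i - eta_rate ?h ?w 0"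
  have h': "(h i has_vector_derivative eta_rate ?h ?w i) (at t within J)" if "i \<le> N" for i
    using obs t that by (auto simp: observer_on_def)
  have w': "(w i has_vector_derivative om_rate ?h i) (at t within J)" if "i \<in> {1..N}" for i
    using obs t that by (auto simp: observer_on_def)
  have "((\<lambda>t. energy (\<lambda>i. h i t - h 0 t) (\<lambda>i. h i t - h 0 t)) has_vector_derivative 2 * energy ?x' ?x) (at t within J)"
    by (rule energy_has_vector_derivative) (auto intro!: has_vector_derivative_diff h')
  from has_vector_derivative_divide[OF this, of 2]
  have d1: "((\<lambda>t. energy (\<lambda>i. h i t - h 0 t) (\<lambda>i. h i t - h 0 t) / 2) has_vector_derivative energy ?x' ?x) (at t within J)"
    by simp
  have sq: "((\<lambda>t. (w i t - om0) \<bullet> (w i t - om0)) has_vector_derivative 2 * mu2 * ((w i t - om0) \<bullet> (phi (?e i) *v h i t)))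
    (at t within J)" if "i \<in> {1..N}" for i
  proof -
    have "((\<lambda>t. w i t - om0) has_vector_derivative om_rate ?h i) (at t within J)"
      using has_vector_derivative_diff[OF w'[OF that] has_vector_derivative_const[of om0]] by simp
    from bounded_bilinear.has_vector_derivative[OF bounded_bilinear_inner this this]
    show ?thesis by (simp add: om_rate_def inner_commute mult.assoc)
  qed
  have d2: "((\<lambda>t. (\<Sum>i=1..N. (w i t - om0) \<bullet> (w i t - om0)) / (2 * mu2)) has_vector_derivative
     (\<Sum>i=1..N. 2 * mu2 * ((w i t - om0) \<bullet> (phi (?e i) *v h i t))) / (2 * mu2)) (at t within J)"
    by (intro has_vector_derivative_divide has_vector_derivative_sum sq)
  \<comment> \<open>The weight \<open>1 / (2 * mu2)\<close> in the Lyapunov function is made to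
    cancel the gain of the frequency update.\<close>
  have d2': "(\<Sum>i=1..N. 2 * mu2 * ((w i t - om0) \<bullet> (phi (?e i) *v h i t))) / (2 * mu2)
     = (\<Sum>i=1..N. (w i t - om0) \<bullet> (phi (?e i) *v h i t))"
    using mu2_pos by (simp flip: sum_distrib_left)
  have ex: "disagreement N E ?x = ?e" by (intro ext disagreement_shift)
  have "energy ?x' ?x = - (\<Sum>i=1..N. ?x' i \<bullet> ?e i)"
    using energy_eq_disagreement[of ?x ?x'] ex by simp
  also have "(\<Sum>i=1..N. ?x' i \<bullet> ?e i) = (\<Sum>i=1..N. (w i t - om0) \<bullet> (phi (?e i) *v h i t)
      + (Smat om0 *v ?x i) \<bullet> ?e i + mu1 * (norm (?e i))\<^sup>2)"
  proof (intro sum.cong refl)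
    fix i assume "i \<in> {1..N}"
    \<comment> \<open>\<open>S(w) h - S(om0) v = S(w - om0) h + S(om0) (h - v)\<close>: the
      frequency error acts on the available estimate \<open>h\<close> and not on \<open>v\<close>,
      which is the product that the update law contains.\<close>
    then have "?x' i = Smat (w i t - om0) *v h i t + Smat om0 *v ?x i + mu1 *\<^sub>R ?e i"
      by (simp add: eta_rate_def Smat_diff_mult matrix_vector_mult_diff_distrib)
    then show "?x' i \<bullet> ?e i = (w i t - om0) \<bullet> (phi (?e i) *v h i t)
      + (Smat om0 *v ?x i) \<bullet> ?e i + mu1 * (norm (?e i))\<^sup>2"
      by (simp only: inner_add_left Smat_inner_eq_phi) (simp add: power2_norm_eq_inner)
  qed
  also have "\<dots> = (\<Sum>i=1..N. (w i t - om0) \<bullet> (phi (?e i) *v h i t))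
      + (\<Sum>i=1..N. (Smat om0 *v ?x i) \<bullet> ?e i) + mu1 * (\<Sum>i=1..N. (norm (?e i))\<^sup>2)"
    by (simp only: sum.distrib sum_distrib_left)
  also have "(\<Sum>i=1..N. (Smat om0 *v ?x i) \<bullet> ?e i) = 0"
    using energy_eq_disagreement[of ?x "\<lambda>i. Smat om0 *v ?x i"] energy_Smat[of om0 ?x] ex by simp
  finally have "energy ?x' ?x + (\<Sum>i=1..N. (w i t - om0) \<bullet> (phi (?e i) *v h i t))
      = - (mu1 * (\<Sum>i=1..N. (norm (?e i))\<^sup>2))" by simp
  with has_vector_derivative_add[OF d1 d2] show ?thesis
    unfolding d2' observer_lyap_def by simp
qed

lemma observer_lyap_bounds:
  shows "energy (\<lambda>i. h i - h 0) (\<lambda>i. h i - h 0) \<le> 2 * observer_lyap h w"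
    and "i \<in> {1..N} \<Longrightarrow> (norm (w i - om0))\<^sup>2 \<le> 2 * mu2 * observer_lyap h w"
    and "0 \<le> observer_lyap h w"
proof -
  let ?W = "\<lambda>i. (w i - om0) \<bullet> (w i - om0)"
  have W: "0 \<le> (\<Sum>i=1..N. ?W i) / (2 * mu2)"
    using mu2_pos by (intro divide_nonneg_pos sum_nonneg) auto
  have en: "0 \<le> energy (\<lambda>i. h i - h 0) (\<lambda>i. h i - h 0)" by (rule energy_nonneg)
  have "a \<le> 2 * (a / 2 + b) \<and> 0 \<le> a / 2 + b" if "0 \<le> a" "0 \<le> b" for a b :: real
    using that by auto
  from this[OF en W] show "energy (\<lambda>i. h i - h 0) (\<lambda>i. h i - h 0) \<le> 2 * observer_lyap h w"
    "0 \<le> observer_lyap h w" unfolding observer_lyap_def by blast+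
  show "(norm (w i - om0))\<^sup>2 \<le> 2 * mu2 * observer_lyap h w" if "i \<in> {1..N}"
  proof -
    have "?W i \<le> (\<Sum>i=1..N. ?W i)" using that by (intro member_le_sum) auto
    also have "\<dots> = 2 * mu2 * ((\<Sum>i=1..N. ?W i) / (2 * mu2))" using mu2_pos by simp
    also have "\<dots> \<le> 2 * mu2 * observer_lyap h w"
      unfolding observer_lyap_def using en mu2_pos by (intro mult_left_mono) auto
    finally show ?thesis by (simp add: power2_norm_eq_inner)
  qed
qed

text \<open>\<open>R\<close> is fixed before the horizon \<open>T\<close> and the solution, and
  depends on the initial state only; the existence proof rests on this order of quantifiers.\<close>

lemma observer_uniform_bound:
  obtains R where "\<And>T h w. T \<ge> 0 \<Longrightarrow> observer_on {0..T} h w \<Longrightarrow> (\<And>i. i \<le> N \<Longrightarrow> h i 0 = h0 i) \<Longrightarrow>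
      (\<And>i. i \<in> {1..N} \<Longrightarrow> w i 0 = w0 i) \<Longrightarrow>
      (\<forall>i\<le>N. norm (h i T) \<le> R) \<and> (\<forall>i\<in>{1..N}. norm (w i T) \<le> R)"
proof -
  obtain c where c: "c \<ge> 0"
    "\<And>(x :: nat \<Rightarrow> real^('l \<times> half)) i. x 0 = 0 \<Longrightarrow> i \<le> N \<Longrightarrow> norm (x i) \<le> c * sqrt (2 * energy x x)"
    using energy_coercive by blast
  define V0 where "V0 = observer_lyap h0 w0"
  \<comment> \<open>Separate estimates are added up: the norm of the leader is conserved, the errors
    are bounded through coercivity, the frequency errors through their share of the Lyapunov
    function.\<close>
  define R where "R = norm (h0 0) + c * sqrt (2 * (2 * V0)) + norm om0 + sqrt (2 * mu2 * V0)"
  have V0: "V0 \<ge> 0" unfolding V0_def by (rule observer_lyap_bounds)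
  show thesis
  proof (rule that[of R], intro conjI allI ballI impI)
    fix T h w assume T: "(T::real) \<ge> 0" and obs: "observer_on {0..T} h w"
      and ih: "\<And>i. i \<le> N \<Longrightarrow> h i 0 = h0 i" and iw: "\<And>i. i \<in> {1..N} \<Longrightarrow> w i 0 = w0 i"
    have "observer_lyap (\<lambda>i. h i T) (\<lambda>i. w i T) \<le> observer_lyap (\<lambda>i. h i 0) (\<lambda>i. w i 0)"
      by (rule nonincreasing_of_derivative[OF T observer_lyap_derivative[OF obs]])
        (use mu1_pos in \<open>auto intro!: mult_nonneg_nonneg sum_nonneg\<close>)
    also have "\<dots> = V0"
      unfolding V0_def observer_lyap_def energy_def using ih iw by simp
    finally have V: "observer_lyap (\<lambda>i. h i T) (\<lambda>i. w i T) \<le> V0" .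
    have "h 0 T \<bullet> h 0 T \<le> h 0 0 \<bullet> h 0 0"
    proof (rule nonincreasing_of_derivative[OF T, where V'="\<lambda>_. 0"])
      fix s assume s: "s \<in> {0..T}"
      then have d: "(h 0 has_vector_derivative Smat om0 *v h 0 s) (at s within {0..T})"
        using obs unfolding observer_on_def eta_rate_def by fastforce
      from bounded_bilinear.has_vector_derivative[OF bounded_bilinear_inner d d]
      show "((\<lambda>t. h 0 t \<bullet> h 0 t) has_vector_derivative 0) (at s within {0..T})"
        by (simp add: Smat_skew)
    qed simp
    then have h0: "norm (h 0 T) \<le> norm (h0 0)" using ih by (simp add: norm_eq_sqrt_inner)
    fix i
    {
      assume i: "i \<le> N"
      have "norm (h i T) \<le> norm (h 0 T) + norm (h i T - h 0 T)" by (rule norm_triangle_sub)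
      also have "norm (h i T - h 0 T) \<le> c * sqrt (2 * energy (\<lambda>i. h i T - h 0 T) (\<lambda>i. h i T - h 0 T))"
        using c(2)[of "\<lambda>i. h i T - h 0 T" i] i by simp
      also have "\<dots> \<le> c * sqrt (2 * (2 * V0))"
        using observer_lyap_bounds(1)[of "\<lambda>i. h i T" "\<lambda>i. w i T"] V c(1) by (intro mult_left_mono) auto
      finally show "norm (h i T) \<le> R" unfolding R_def using h0 V0 mu2_pos
        by (smt (verit) mult_nonneg_nonneg norm_ge_zero real_sqrt_ge_zero)
    }
    {
      assume i: "i \<in> {1..N}"
      have "(norm (w i T - om0))\<^sup>2 \<le> 2 * mu2 * observer_lyap (\<lambda>i. h i T) (\<lambda>i. w i T)"
        using observer_lyap_bounds(2)[of i "\<lambda>i. w i T" "\<lambda>i. h i T"] i by simp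
      also have "\<dots> \<le> 2 * mu2 * V0" using V mu2_pos by (intro mult_left_mono) auto
      finally have "norm (w i T - om0) \<le> sqrt (2 * mu2 * V0)" by (rule real_le_rsqrt)
      moreover have "norm (w i T) \<le> norm om0 + norm (w i T - om0)" by (rule norm_triangle_sub)
      moreover have "0 \<le> c * sqrt (2 * (2 * V0))" using c(1) V0 by simp
      ultimately show "norm (w i T) \<le> R" unfolding R_def using norm_ge_zero[of "h0 0"] by linarith
    }
  qed
qed

lemma observer_bounded:
  assumes obs: "observer_on {0..} h w"
  shows "i \<le> N \<Longrightarrow> bounded (h i ` {0..})" and "i \<in> {1..N} \<Longrightarrow> bounded (w i ` {0..})"
proof -
  obtain R where R: "\<And>T h' w'. T \<ge> 0 \<Longrightarrow> observer_on {0..T} h' w' \<Longrightarrow> (\<And>i. i \<le> N \<Longrightarrow> h' i 0 = h i 0) \<Longrightarrow>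
      (\<And>i. i \<in> {1..N} \<Longrightarrow> w' i 0 = w i 0) \<Longrightarrow>
      (\<forall>i\<le>N. norm (h' i T) \<le> R) \<and> (\<forall>i\<in>{1..N}. norm (w' i T) \<le> R)"
    using observer_uniform_bound[of "\<lambda>i. h i 0" "\<lambda>i. w i 0"] by blast
  have "(\<forall>i\<le>N. norm (h i T) \<le> R) \<and> (\<forall>i\<in>{1..N}. norm (w i T) \<le> R)" if "T \<ge> 0" for T
    by (rule R) (use that observer_on_subset[OF obs] in auto)
  then show "i \<le> N \<Longrightarrow> bounded (h i ` {0..})" and "i \<in> {1..N} \<Longrightarrow> bounded (w i ` {0..})"
    unfolding bounded_iff by (auto intro!: exI[of _ R])
qed

lemma disagreement_has_vector_derivative:
  assumes "\<And>j. j \<le> N \<Longrightarrow> (h j has_vector_derivative h' j) (at t within J)" "i \<le> N"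
  shows "((\<lambda>t. disagreement N E (\<lambda>j. h j t) i) has_vector_derivative disagreement N E h' i) (at t within J)"
  unfolding disagreement_def
  by (intro has_vector_derivative_sum has_vector_derivative_diff assms) (auto simp: nbrs_def assms)

lemma bounded_disagreement:
  fixes h :: "nat \<Rightarrow> real \<Rightarrow> 'a::real_normed_vector"
  assumes "\<And>j. j \<le> N \<Longrightarrow> bounded (h j ` S)" "i \<le> N"
  shows "bounded ((\<lambda>t. disagreement N E (\<lambda>j. h j t) i) ` S)"
  unfolding disagreement_def
  by (intro bounded_image_sum bounded_minus_comp assms) (auto simp: nbrs_def assms)

lemma observer_rates_bounded:
  assumes obs: "observer_on {0..} h w"
  shows "i \<le> N \<Longrightarrow> bounded ((\<lambda>t. eta_rate (\<lambda>j. h j t) (\<lambda>j. w j t) i) ` {0..})"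
    and "i \<in> {1..N} \<Longrightarrow> bounded ((\<lambda>t. om_rate (\<lambda>j. h j t) i) ` {0..})"
proof -
  note b = observer_bounded[OF obs]
  show "bounded ((\<lambda>t. eta_rate (\<lambda>j. h j t) (\<lambda>j. w j t) i) ` {0..})" if "i \<le> N"
  proof (cases "i = 0")
    case True
    have "bounded ((\<lambda>t. Smat om0 *v h 0 t) ` {0..})"
      by (rule bounded_image_bilinear[OF bounded_bilinear_Smat bounded_image_const]) (use b in auto)
    then show ?thesis unfolding eta_rate_def using True by simp
  next
    case False
    have "bounded ((\<lambda>t. Smat (w i t) *v h i t + mu1 *\<^sub>R disagreement N E (\<lambda>j. h j t) i) ` {0..})"
      by (intro bounded_plus_comp bounded_image_bilinear[OF bounded_bilinear_Smat] bounded_scaleR_comp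
          bounded_disagreement b) (use that False in auto)
    then show ?thesis unfolding eta_rate_def using False by simp
  qed
  show "bounded ((\<lambda>t. om_rate (\<lambda>j. h j t) i) ` {0..})" if "i \<in> {1..N}"
    unfolding om_rate_def
    by (intro bounded_scaleR_comp bounded_image_bilinear[OF bounded_bilinear_phi] bounded_disagreement b)
      (use that in auto)
qed

text \<open>Tracking uses all three limits: the first enters the input of the position filter, the
  second moves the target from the estimate to the leader, the third does the same for
  velocities.\<close>

theorem observer_convergence:
  assumes obs: "observer_on {0..} h w" and i: "i \<in> {1..N}"
  shows "((\<lambda>t. disagreement N E (\<lambda>j. h j t) i) \<longlongrightarrow> 0) at_top"
    and "((\<lambda>t. h i t - h 0 t) \<longlongrightarrow> 0) at_top"
    and "((\<lambda>t. eta_rate (\<lambda>j. h j t) (\<lambda>j. w j t) i - Smat om0 *v h 0 t) \<longlongrightarrow> 0) at_top"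
proof -
  let ?r = "\<lambda>i t. eta_rate (\<lambda>j. h j t) (\<lambda>j. w j t) i"
  let ?e = "\<lambda>i t. disagreement N E (\<lambda>j. h j t) i"
  let ?e' = "\<lambda>i t. disagreement N E (\<lambda>j. ?r j t) i"
  note b = observer_bounded[OF obs] and rb = observer_rates_bounded[OF obs]
  have h': "(h i has_vector_derivative ?r i t) (at t within {0..})" if "i \<le> N" "t \<ge> 0" for i t
    using obs that by (auto simp: observer_on_def)
  have w': "(w i has_vector_derivative om_rate (\<lambda>j. h j t) i) (at t within {0..})" if "i \<in> {1..N}" "t \<ge> 0" for i t
    using obs that by (auto simp: observer_on_def)
  have e': "(?e i has_vector_derivative ?e' i t) (at t within {0..})" if "i \<le> N" "t \<ge> 0" for i t
    by (rule disagreement_has_vector_derivative) (use that h' in auto)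
  have eb: "bounded (?e i ` {0..})" if "i \<le> N" for i
    by (rule bounded_disagreement) (use b that in auto)
  have eb': "bounded (?e' i ` {0..})" if "i \<le> N" for i
    by (rule bounded_disagreement) (use rb that in auto)
  \<comment> \<open>The dissipation rate; its derivative \<open>?g'\<close> is a polynomial in
    bounded signals.\<close>
  let ?g = "\<lambda>t. mu1 * (\<Sum>i=1..N. (norm (?e i t))\<^sup>2)"
  let ?g' = "\<lambda>t. mu1 * (\<Sum>i=1..N. 2 * (?e i t \<bullet> ?e' i t))"
  have "bounded (?g' ` {0..})"
    unfolding real_scaleR_def[symmetric]
    by (intro bounded_scaleR_comp bounded_image_sum bounded_image_bilinear[OF bounded_bilinear_inner] eb eb') auto
  then obtain L where L: "\<And>t. t \<ge> 0 \<Longrightarrow> \<bar>?g' t\<bar> \<le> L" by (force simp: bounded_iff)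
  have g: "(?g \<longlongrightarrow> 0) at_top"
  proof (rule Lyapunov_Barbalat[where V="\<lambda>t. observer_lyap (\<lambda>i. h i t) (\<lambda>i. w i t)" and g'="?g'" and L=L])
    fix t :: real assume t: "t \<ge> 0"
    show "((\<lambda>t. observer_lyap (\<lambda>i. h i t) (\<lambda>i. w i t)) has_vector_derivative - ?g t) (at t within {0..})"
      by (rule observer_lyap_derivative[OF obs]) (use t in simp)
    have "((\<lambda>t. (norm (?e i t))\<^sup>2) has_vector_derivative 2 * (?e i t \<bullet> ?e' i t)) (at t within {0..})"
      if "i \<in> {1..N}" for i
    proof -
      have "i \<le> N" using that by simp
      note d = e'[OF this t]
      from bounded_bilinear.has_vector_derivative[OF bounded_bilinear_inner d d]
      show ?thesis by (simp add: power2_norm_eq_inner inner_commute)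
    qed
    then show "(?g has_vector_derivative ?g' t) (at t within {0..})"
      by (intro has_vector_derivative_mult_right has_vector_derivative_sum)
    show "\<bar>?g' t\<bar> \<le> L" by (rule L[OF t])
    show "0 \<le> observer_lyap (\<lambda>i. h i t) (\<lambda>i. w i t)" by (rule observer_lyap_bounds)
    show "0 \<le> ?g t" using mu1_pos by (intro mult_nonneg_nonneg sum_nonneg) auto
  qed
  have e0: "(?e i \<longlongrightarrow> 0) at_top" if i: "i \<in> {1..N}" for i
  proof -
    have "((\<lambda>t. sqrt (?g t / mu1)) \<longlongrightarrow> sqrt (0 / mu1)) at_top"
      using mu1_pos by (intro tendsto_real_sqrt tendsto_divide g tendsto_const) auto
    then have "((\<lambda>t. sqrt (?g t / mu1)) \<longlongrightarrow> 0) at_top" by simp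
    then show ?thesis
    proof (rule Lim_null_comparison[rotated], intro always_eventually allI)
      fix t
      have "(norm (?e i t))\<^sup>2 \<le> (\<Sum>i=1..N. (norm (?e i t))\<^sup>2)" using i by (intro member_le_sum) auto
      also have "\<dots> = ?g t / mu1" using mu1_pos by simp
      finally show "norm (?e i t) \<le> sqrt (?g t / mu1)" by (rule real_le_rsqrt)
    qed
  qed
  then show "(?e i \<longlongrightarrow> 0) at_top" using i by blast
  \<comment> \<open>The energy of the errors is minus the sum of their inner products with
    \<open>?e\<close>, that is, bounded times vanishing. Coercivity transfers the limit to each
    error.\<close>
  have x0: "((\<lambda>t. h i t - h 0 t) \<longlongrightarrow> 0) at_top" if i: "i \<le> N" for i
  proof -
    let ?en = "\<lambda>t. energy (\<lambda>i. h i t - h 0 t) (\<lambda>i. h i t - h 0 t)"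
    have en: "?en t = - (\<Sum>i=1..N. (h i t - h 0 t) \<bullet> ?e i t)" for t
      using energy_eq_disagreement[of "\<lambda>i. h i t - h 0 t" "\<lambda>i. h i t - h 0 t"]
      by (simp add: disagreement_shift)
    have "((\<lambda>t. (h i t - h 0 t) \<bullet> ?e i t) \<longlongrightarrow> 0) at_top" if "i \<in> {1..N}" for i
    proof -
      have "bounded ((\<lambda>t. h i t - h 0 t) ` {0..})"
        by (intro bounded_minus_comp b) (use that in auto)
      then obtain B where B: "\<And>t. t \<ge> 0 \<Longrightarrow> norm (h i t - h 0 t) \<le> B" by (force simp: bounded_iff)
      show ?thesis
      proof (rule Lim_null_comparison)
        show "eventually (\<lambda>t. norm ((h i t - h 0 t) \<bullet> ?e i t) \<le> B * norm (?e i t)) at_top"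
          using eventually_ge_at_top[of 0]
        proof eventually_elim
          case (elim t)
          have "norm ((h i t - h 0 t) \<bullet> ?e i t) \<le> norm (h i t - h 0 t) * norm (?e i t)"
            using Cauchy_Schwarz_ineq2 by simp
          also have "\<dots> \<le> B * norm (?e i t)" using B[OF elim] by (intro mult_right_mono) auto
          finally show ?case .
        qed
        show "((\<lambda>t. B * norm (?e i t)) \<longlongrightarrow> 0) at_top"
          using tendsto_mult_right_zero[OF tendsto_norm_zero[OF e0[OF that]], of B] .
      qed
    qed
    then have "(?en \<longlongrightarrow> - (\<Sum>i=1..N. 0)) at_top"
      unfolding en by (intro tendsto_minus tendsto_sum) auto
    then have en0: "(?en \<longlongrightarrow> 0) at_top" by simp
    obtain c where "c \<ge> 0" and c: "\<And>(x :: nat \<Rightarrow> real^('l \<times> half)) i. x 0 = 0 \<Longrightarrow> i \<le> N \<Longrightarrow> norm (x i) \<le> c * sqrt (2 * energy x x)"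
      using energy_coercive by blast
    have "((\<lambda>t. c * sqrt (2 * ?en t)) \<longlongrightarrow> c * sqrt (2 * 0)) at_top"
      by (intro tendsto_intros en0)
    then have "((\<lambda>t. c * sqrt (2 * ?en t)) \<longlongrightarrow> 0) at_top" by simp
    then show ?thesis
      by (rule Lim_null_comparison[rotated])
        (use c[of "\<lambda>i. h i _ - h 0 _" i] i in \<open>auto intro!: always_eventually\<close>)
  qed
  have iN: "i \<le> N" using i by simp
  then show "((\<lambda>t. h i t - h 0 t) \<longlongrightarrow> 0) at_top" by (rule x0)
  \<comment> \<open>The second derivative of the error, by the product rule from the rates of
    \<open>h\<close> and \<open>w\<close>.\<close>
  let ?d = "\<lambda>t. Smat (w i t) *v ?r i t + Smat (om_rate (\<lambda>j. h j t) i) *v h i t + mu1 *\<^sub>R ?e' i t - Smat om0 *v ?r 0 t"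
  have "bounded (?d ` {0..})"
    by (intro bounded_minus_comp bounded_plus_comp bounded_scaleR_comp
        bounded_image_bilinear[OF bounded_bilinear_Smat] bounded_image_const b rb eb') (use i in auto)
  then obtain B where B: "\<And>t. t \<ge> 0 \<Longrightarrow> norm (?d t) \<le> B" by (force simp: bounded_iff)
  show "((\<lambda>t. ?r i t - Smat om0 *v h 0 t) \<longlongrightarrow> 0) at_top"
  proof (rule Barbalat[where f="\<lambda>t. h i t - h 0 t" and g'="?d" and L=B and l=0])
    fix t :: real assume t: "t \<ge> 0"
    have "?r 0 t = Smat om0 *v h 0 t" by (simp add: eta_rate_def)
    then show "((\<lambda>t. h i t - h 0 t) has_vector_derivative ?r i t - Smat om0 *v h 0 t) (at t within {0..})"
      using has_vector_derivative_diff[OF h'[OF iN t] h'[OF _ t, of 0]] by simp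
    have ri: "Smat (w i s) *v h i s + mu1 *\<^sub>R ?e i s = ?r i s" for s using i by (auto simp: eta_rate_def)
    have "((\<lambda>t. Smat (w i t) *v h i t + mu1 *\<^sub>R ?e i t - Smat om0 *v h 0 t) has_vector_derivative
       (Smat (w i t) *v ?r i t + Smat (om_rate (\<lambda>j. h j t) i) *v h i t) + mu1 *\<^sub>R ?e' i t
          - (Smat om0 *v ?r 0 t + Smat 0 *v h 0 t)) (at t within {0..})"
      by (intro has_vector_derivative_diff has_vector_derivative_add
          bounded_bilinear.has_vector_derivative[OF bounded_bilinear_Smat] has_vector_derivative_const
          bounded_linear.has_vector_derivative[OF bounded_linear_scaleR_right] h' w' e') (use i t in auto)
    note this[unfolded ri]
    moreover have "Smat 0 *v h 0 t = 0" using bounded_bilinear.zero_left[OF bounded_bilinear_Smat] .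
    ultimately show "((\<lambda>t. ?r i t - Smat om0 *v h 0 t) has_vector_derivative ?d t) (at t within {0..})"
      by simp
    show "norm (?d t) \<le> B" by (rule B[OF t])
  qed (rule x0[OF iN])
qed

end

section \<open>Adaptive tracking of an Euler--Lagrange system\<close>

text \<open>The form attains its minimum on the compact unit sphere, and homogeneity of degree 2
  extends the bound to all vectors.\<close>

lemma positive_form_coercive:
  fixes A :: "real^'n^'n"
  assumes pos: "\<And>x. x \<noteq> 0 \<Longrightarrow> x \<bullet> (A *v x) > 0"
  obtains c where "c > 0" "\<And>x. c * (norm x)\<^sup>2 \<le> x \<bullet> (A *v x)"
proof -
  have "continuous_on (sphere 0 1) (\<lambda>x. x \<bullet> (A *v x))" by (intro continuous_intros)
  moreover have "compact (sphere (0 :: real^'n) 1)" "sphere (0 :: real^'n) 1 \<noteq> {}" by auto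
  ultimately obtain m where m: "m \<in> sphere 0 1" "\<And>x. x \<in> sphere 0 1 \<Longrightarrow> m \<bullet> (A *v m) \<le> x \<bullet> (A *v x)"
    using continuous_attains_inf[of "sphere (0 :: real^'n) 1"] by blast
  show thesis
  proof (rule that[of "m \<bullet> (A *v m)"])
    have "m \<noteq> 0" using m(1) by auto
    then show "m \<bullet> (A *v m) > 0" by (rule pos)
    fix x :: "real^'n"
    show "m \<bullet> (A *v m) * (norm x)\<^sup>2 \<le> x \<bullet> (A *v x)"
    proof (cases "x = 0")
      case False
      define u where "u = inverse (norm x) *\<^sub>R x"
      have x: "x = norm x *\<^sub>R u" and "u \<in> sphere 0 1" using False by (auto simp: u_def)
      then have "m \<bullet> (A *v m) \<le> u \<bullet> (A *v u)" using m by blast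
      then have "m \<bullet> (A *v m) * (norm x)\<^sup>2 \<le> u \<bullet> (A *v u) * (norm x)\<^sup>2"
        by (intro mult_right_mono) auto
      also have "\<dots> = (norm x *\<^sub>R u) \<bullet> (A *v (norm x *\<^sub>R u))"
        by (simp add: matrix_vector_mult_scaleR power2_eq_square)
      finally show ?thesis using x by simp
    qed simp
  qed
qed

lemma symmetric_matrix_inner:
  fixes A :: "real^'n^'n"
  assumes "transpose A = A"
  shows "x \<bullet> (A *v y) = (A *v x) \<bullet> y"
  using assms dot_lmul_matrix[of x A y] by (metis transpose_matrix_vector)

lemma skew_matrix_inner:
  fixes A :: "real^'n^'n"
  assumes "transpose A = - A"
  shows "x \<bullet> (A *v x) = 0"
proof -
  have "x \<bullet> (A *v x) = (transpose A *v x) \<bullet> x" using dot_lmul_matrix[of x A x] by simp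
  also have "\<dots> = - (x \<bullet> (A *v x))" unfolding assms
    using bounded_bilinear.minus_left[OF bounded_bilinear_matrix_vector_mult, of A x] by (simp add: inner_commute)
  finally show ?thesis by simp
qed

text \<open>A positive form has trivial kernel, and an injective square matrix has a two-sided
  inverse, which is what \<open>matrix_inv\<close> then selects.\<close>

lemma matrix_inv_mult_vector:
  fixes A :: "real^'n^'n"
  assumes "\<And>x. x \<noteq> 0 \<Longrightarrow> x \<bullet> (A *v x) > 0"
  shows "A *v (matrix_inv A *v w) = w"
proof -
  have "inj ((*v) A)"
  proof (rule injI)
    fix x y assume "A *v x = A *v y"
    then have "(x - y) \<bullet> (A *v (x - y)) = 0" by (simp add: matrix_vector_mult_diff_distrib)
    then show "x = y" using assms[of "x - y"] by force
  qed
  then obtain B where "B ** A = mat 1" using matrix_left_invertible_injective by blast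
  then have "\<exists>B. A ** B = mat 1 \<and> B ** A = mat 1" using matrix_left_right_inverse by blast
  then have "A ** matrix_inv A = mat 1" unfolding matrix_inv_def by (rule someI2_ex) blast
  then show ?thesis by (simp add: matrix_vector_mul_assoc)
qed

text \<open>Cauchy-Schwarz turns the quadratic bound into one for the inverse. It controls both how
  the acceleration depends on the state and how large it is along a trajectory.\<close>

lemma coercive_norm_le:
  fixes A :: "real^'n^'n"
  assumes "c > 0" "c * (norm d)\<^sup>2 \<le> d \<bullet> (A *v d)"
  shows "norm d \<le> norm (A *v d) / c"
proof (cases "d = 0")
  case False
  have "c * norm d * norm d \<le> norm (A *v d) * norm d"
    using assms(2) Cauchy_Schwarz_ineq2[of d "A *v d"] by (simp add: power2_eq_square mult_ac)
  then have "c * norm d \<le> norm (A *v d)" using False by simp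
  then show ?thesis using assms(1) by (simp add: field_simps)
qed (use assms in simp)

text \<open>With the solution at \<open>x\<close> frozen, the residual at a nearby \<open>y\<close>
  tends to 0, and coercivity with one constant on \<open>S\<close> bounds the change of the solution
  by that residual.\<close>

lemma continuous_on_matrix_inv_mult:
  fixes A :: "'x::topological_space \<Rightarrow> real^'n^'n"
  assumes c: "c > 0" "\<And>x y. x \<in> S \<Longrightarrow> c * (norm y)\<^sup>2 \<le> y \<bullet> (A x *v y)"
    and A: "continuous_on S A" and w: "continuous_on S w"
  shows "continuous_on S (\<lambda>x. matrix_inv (A x) *v w x)"
  unfolding continuous_on_def
proof
  let ?a = "\<lambda>x. matrix_inv (A x) *v w x"
  fix x assume x: "x \<in> S"
  have solve: "A y *v ?a y = w y" if "y \<in> S" for y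
    by (rule matrix_inv_mult_vector)
      (metis c less_le_trans mult_pos_pos that zero_less_norm_iff zero_less_power)
  have "((\<lambda>y. norm (w y - A y *v ?a x) / c) \<longlongrightarrow> norm (w x - A x *v ?a x) / c) (at x within S)"
    using A w x c(1) unfolding continuous_on_def
    by (intro tendsto_intros bounded_bilinear.tendsto[OF bounded_bilinear_matrix_vector_mult]) auto
  then have "((\<lambda>y. norm (w y - A y *v ?a x) / c) \<longlongrightarrow> 0) (at x within S)"
    using solve[OF x] by simp
  then have "((\<lambda>y. ?a y - ?a x) \<longlongrightarrow> 0) (at x within S)"
  proof (rule Lim_null_comparison[rotated])
    have "norm (?a y - ?a x) \<le> norm (w y - A y *v ?a x) / c" if "y \<in> S" for y
      using coercive_norm_le[OF c(1) c(2)[OF that], of "?a y - ?a x"] solve[OF that]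
      by (simp add: matrix_vector_mult_diff_distrib)
    then show "eventually (\<lambda>y. norm (?a y - ?a x) \<le> norm (w y - A y *v ?a x) / c) (at x within S)"
      by (auto simp: eventually_at_filter)
  qed
  then show "(?a \<longlongrightarrow> ?a x) (at x within S)" using Lim_null by blast
qed

lemma bounded_image_Pair:
  assumes "bounded (f ` S)" "bounded (g ` S)"
  shows "bounded ((\<lambda>x. (f x, g x)) ` S)"
  by (rule bounded_subset[OF bounded_Times[OF assms]]) auto

lemma bounded_image_continuous:
  fixes g :: "'b \<Rightarrow> 'a::heine_borel"
  assumes "continuous_on UNIV f" "bounded (g ` S)"
  shows "bounded ((\<lambda>x. f (g x)) ` S)"
proof -
  have "compact (f ` closure (g ` S))"
    using assms by (intro compact_continuous_image) (auto intro: continuous_on_subset)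
  then have "bounded (f ` closure (g ` S))" by (rule compact_imp_bounded)
  then show ?thesis
    by (rule bounded_subset) (use closure_subset[of "g ` S"] in auto)
qed

section \<open>One follower with an arbitrary reference\<close>

locale euler_lagrange =
  fixes M :: "real^'n \<Rightarrow> real^'n^'n" and DM :: "real^'n \<Rightarrow> real^'n \<Rightarrow> real^'n^'n"
    and Cc :: "real^'n \<Rightarrow> real^'n \<Rightarrow> real^'n^'n" and G :: "real^'n \<Rightarrow> real^'n"
    and Y :: "real^'n \<Rightarrow> real^'n \<Rightarrow> real^'n \<Rightarrow> real^'n \<Rightarrow> real^'p^'n" and Theta :: "real^'p"
    and K :: "real^'n^'n" and Lam :: "real^'p^'p"
  assumes M_sym: "\<And>x. transpose (M x) = M x"
    and M_pd: "\<exists>c>0. \<forall>x y. c * (norm y)\<^sup>2 \<le> y \<bullet> (M x *v y)"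
    and regressor: "\<And>x xd a b. M x *v a + Cc x xd *v b + G x = Y x xd a b *v Theta"
    and M_deriv: "\<And>x. (M has_derivative DM x) (at x)"
    and skew: "\<And>x xd. transpose (DM x xd - 2 *\<^sub>R Cc x xd) = - (DM x xd - 2 *\<^sub>R Cc x xd)"
    and Cc_cont: "continuous_on UNIV (\<lambda>(x, xd). Cc x xd)"
    and Y_cont: "continuous_on UNIV (\<lambda>(x, xd, a, b). Y x xd a b)"
    and K_pd: "pos_def_mat K" and Lam_pd: "pos_diag_mat Lam"
begin

text \<open>The reference velocity \<open>r\<close> is any signal with derivative \<open>r'\<close>,
  which detaches the tracking analysis from the observer that generates it.\<close>

definition tracking_on :: "real set \<Rightarrow> (real \<Rightarrow> real^'n) \<Rightarrow> (real \<Rightarrow> real^'n) \<Rightarrow>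
    (real \<Rightarrow> real^'n) \<Rightarrow> (real \<Rightarrow> real^'n) \<Rightarrow> (real \<Rightarrow> real^'p) \<Rightarrow> bool" where
  "tracking_on J r r' q qd th \<longleftrightarrow> (\<forall>t\<in>J.
     (r has_vector_derivative r' t) (at t within J) \<and>
     (q has_vector_derivative qd t) (at t within J) \<and>
     (\<exists>acc. (qd has_vector_derivative acc) (at t within J) \<and>
        M (q t) *v acc + Cc (q t) (qd t) *v qd t + G (q t)
          = - (K *v (qd t - r t)) + Y (q t) (qd t) (r' t) (r t) *v th t) \<and>
     (th has_vector_derivative
        - (matrix_inv Lam *v (transpose (Y (q t) (qd t) (r' t) (r t)) *v (qd t - r t)))) (at t within J))"

definition tracking_lyap :: "real^'n \<Rightarrow> real^'n \<Rightarrow> real^'p \<Rightarrow> real" where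
  "tracking_lyap x s \<theta> = (s \<bullet> (M x *v s) + (\<theta> - Theta) \<bullet> (Lam *v (\<theta> - Theta))) / 2"

lemma tracking_on_subset: "tracking_on J r r' q qd th \<Longrightarrow> I \<subseteq> J \<Longrightarrow> tracking_on I r r' q qd th"
  unfolding tracking_on_def by (meson has_vector_derivative_within_subset subsetD)

lemma Lam_sym: "transpose Lam = Lam"
proof -
  have "Lam $ j $ i = Lam $ i $ j" for i j
    using Lam_pd unfolding pos_diag_mat_def by (cases "i = j") auto
  then show ?thesis by (simp add: transpose_def vec_eq_iff)
qed

lemma Lam_pos:
  assumes "x \<noteq> 0"
  shows "x \<bullet> (Lam *v x) > 0"
proof -
  have "(Lam *v x) $ i = Lam $ i $ i * x $ i" for i
  proof -
    have "(Lam *v x) $ i = (\<Sum>j\<in>UNIV. if j = i then Lam $ i $ i * x $ i else 0)"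
      unfolding matrix_vector_mult_def vec_lambda_beta
      using Lam_pd by (intro sum.cong) (auto simp: pos_diag_mat_def)
    then show ?thesis by simp
  qed
  then have eq: "x \<bullet> (Lam *v x) = (\<Sum>i\<in>UNIV. Lam $ i $ i * (x $ i)\<^sup>2)"
    by (simp add: inner_vec_def power2_eq_square algebra_simps)
  obtain k where "x $ k \<noteq> 0" using assms by (metis vec_eq_iff zero_index)
  then show ?thesis unfolding eq using Lam_pd
    by (intro sum_pos2[of _ k]) (auto simp: pos_diag_mat_def less_imp_le)
qed

text \<open>Subtracting property (P2) at the reference, \<open>M r' + C r + G = Y Theta\<close>,
  from the plant equation removes \<open>G\<close> and leaves \<open>C\<close> acting on the error
  alone.\<close>

lemma tracking_error_dynamics:
  assumes "M x *v acc + Cc x xd *v xd + G x = - (K *v (xd - r)) + Y x xd r' r *v th"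
  shows "M x *v (acc - r') = Y x xd r' r *v (th - Theta) - K *v (xd - r) - Cc x xd *v (xd - r)"
proof -
  have th: "Y x xd r' r *v th = M x *v acc + Cc x xd *v xd + G x + K *v (xd - r)"
    using assms by simp
  show ?thesis
    unfolding matrix_vector_mult_diff_distrib[of "Y x xd r' r"] th regressor[symmetric]
    by (simp add: matrix_vector_mult_diff_distrib)
qed

text \<open>Differentiating \<open>M (q t)\<close> contributes a term in \<open>DM\<close>, which by
  (P3) cancels the Coriolis term; the adaptation law cancels the regressor term, and only the
  damping by \<open>K\<close> survives.\<close>

lemma tracking_lyap_derivative:
  assumes tr: "tracking_on J r r' q qd th" and t: "t \<in> J"
  shows "((\<lambda>t. tracking_lyap (q t) (qd t - r t) (th t)) has_vector_derivative
    - ((qd t - r t) \<bullet> (K *v (qd t - r t)))) (at t within J)"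
proof -
  let ?s = "qd t - r t" and ?Y = "Y (q t) (qd t) (r' t) (r t)" and ?\<theta> = "th t - Theta"
  let ?\<theta>' = "- (matrix_inv Lam *v (transpose ?Y *v ?s))"
  obtain acc where qd': "(qd has_vector_derivative acc) (at t within J)"
    and eq: "M (q t) *v acc + Cc (q t) (qd t) *v qd t + G (q t) = - (K *v ?s) + ?Y *v th t"
    using tr t by (auto simp: tracking_on_def)
  have r': "(r has_vector_derivative r' t) (at t within J)"
    and q': "(q has_vector_derivative qd t) (at t within J)"
    and th': "(th has_vector_derivative ?\<theta>') (at t within J)"
    using tr t by (auto simp: tracking_on_def)
  have s': "((\<lambda>t. qd t - r t) has_vector_derivative acc - r' t) (at t within J)"
    by (rule has_vector_derivative_diff[OF qd' r'])
  have "((\<lambda>t. M (q t)) has_derivative (\<lambda>h. DM (q t) (h *\<^sub>R qd t))) (at t within J)"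
    using has_derivative_compose[OF q'[unfolded has_vector_derivative_def] M_deriv] .
  moreover have "DM (q t) (h *\<^sub>R qd t) = h *\<^sub>R DM (q t) (qd t)" for h
    using has_derivative_bounded_linear[OF M_deriv] by (simp add: linear_simps)
  ultimately have M': "((\<lambda>t. M (q t)) has_vector_derivative DM (q t) (qd t)) (at t within J)"
    by (simp add: has_vector_derivative_def)
  have kin: "((\<lambda>t. (qd t - r t) \<bullet> (M (q t) *v (qd t - r t))) has_vector_derivative
      ?s \<bullet> (M (q t) *v (acc - r' t) + DM (q t) (qd t) *v ?s) + (acc - r' t) \<bullet> (M (q t) *v ?s)) (at t within J)"
    by (intro bounded_bilinear.has_vector_derivative[OF bounded_bilinear_inner]
        bounded_bilinear.has_vector_derivative[OF bounded_bilinear_matrix_vector_mult] s' M')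
  have \<theta>d: "((\<lambda>t. th t - Theta) has_vector_derivative ?\<theta>') (at t within J)"
    using has_vector_derivative_diff[OF th' has_vector_derivative_const[of Theta]] by simp
  have par: "((\<lambda>t. (th t - Theta) \<bullet> (Lam *v (th t - Theta))) has_vector_derivative
      ?\<theta> \<bullet> (Lam *v ?\<theta>' + 0 *v ?\<theta>) + ?\<theta>' \<bullet> (Lam *v ?\<theta>)) (at t within J)"
    by (intro bounded_bilinear.has_vector_derivative[OF bounded_bilinear_inner]
        bounded_bilinear.has_vector_derivative[OF bounded_bilinear_matrix_vector_mult] \<theta>d has_vector_derivative_const)
  \<comment> \<open>The zero matrix is the derivative of the constant \<open>Lam\<close> in the
    product rule; \<open>Lam\<close> itself cancels its inverse in the adaptation law.\<close>
  have par_eq: "?\<theta> \<bullet> (Lam *v ?\<theta>' + 0 *v ?\<theta>) + ?\<theta>' \<bullet> (Lam *v ?\<theta>) = - 2 * (?s \<bullet> (?Y *v ?\<theta>))"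
  proof -
    have "Lam *v ?\<theta>' = - (transpose ?Y *v ?s)"
      using matrix_inv_mult_vector[OF Lam_pos]
      by (simp add: bounded_bilinear.minus_right[OF bounded_bilinear_matrix_vector_mult] del: transpose_matrix_vector)
    moreover have "?\<theta>' \<bullet> (Lam *v ?\<theta>) = ?\<theta> \<bullet> (Lam *v ?\<theta>')"
      using symmetric_matrix_inner[OF Lam_sym, of ?\<theta>' ?\<theta>] by (simp add: inner_commute)
    ultimately have "?\<theta> \<bullet> (Lam *v ?\<theta>' + 0 *v ?\<theta>) + ?\<theta>' \<bullet> (Lam *v ?\<theta>) = - 2 * (?\<theta> \<bullet> (transpose ?Y *v ?s))"
      by (simp del: transpose_matrix_vector)
    then show ?thesis using dot_lmul_matrix[of ?s ?Y ?\<theta>] by (simp add: inner_commute)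
  qed
  have kin_eq: "?s \<bullet> (M (q t) *v (acc - r' t) + DM (q t) (qd t) *v ?s) + (acc - r' t) \<bullet> (M (q t) *v ?s)
      = 2 * (?s \<bullet> (?Y *v ?\<theta>)) - 2 * (?s \<bullet> (K *v ?s))"
  proof -
    have "(acc - r' t) \<bullet> (M (q t) *v ?s) = ?s \<bullet> (M (q t) *v (acc - r' t))"
      using symmetric_matrix_inner[OF M_sym, of "acc - r' t" "q t" ?s] by (simp add: inner_commute)
    moreover have "?s \<bullet> (DM (q t) (qd t) *v ?s) = 2 * (?s \<bullet> (Cc (q t) (qd t) *v ?s))"
      using skew_matrix_inner[OF skew, of ?s "q t" "qd t"]
      by (simp add: matrix_vector_mult_diff_rdistrib inner_diff_right
          bounded_bilinear.scaleR_left[OF bounded_bilinear_matrix_vector_mult])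
    ultimately show ?thesis
      unfolding tracking_error_dynamics[OF eq] by (simp add: inner_add_right inner_diff_right)
  qed
  have "((\<lambda>t. tracking_lyap (q t) (qd t - r t) (th t)) has_vector_derivative
     ((2 * (?s \<bullet> (?Y *v ?\<theta>)) - 2 * (?s \<bullet> (K *v ?s))) + (- 2 * (?s \<bullet> (?Y *v ?\<theta>)))) / 2) (at t within J)"
    unfolding tracking_lyap_def
    using has_vector_derivative_divide[OF has_vector_derivative_add[OF kin par]] unfolding kin_eq par_eq .
  then show ?thesis by simp
qed

lemma tracking_lyap_coercive:
  obtains c where "c > 0" "\<And>x s \<theta>. c * (norm s)\<^sup>2 \<le> tracking_lyap x s \<theta>"
    "\<And>x s \<theta>. c * (norm (\<theta> - Theta))\<^sup>2 \<le> tracking_lyap x s \<theta>"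
proof -
  obtain a where a: "a > 0" "\<And>x y. a * (norm y)\<^sup>2 \<le> y \<bullet> (M x *v y)" using M_pd by blast
  obtain b where b: "b > 0" "\<And>x. b * (norm x)\<^sup>2 \<le> x \<bullet> (Lam *v x)"
    using positive_form_coercive[OF Lam_pos] by blast
  show thesis
  proof (rule that[of "min a b / 2"])
    show "min a b / 2 > 0" using a b by simp
    fix x s :: "real^'n" and \<theta>
    have s: "min a b * (norm s)\<^sup>2 \<le> a * (norm s)\<^sup>2" and
      th: "min a b * (norm (\<theta> - Theta))\<^sup>2 \<le> b * (norm (\<theta> - Theta))\<^sup>2" by (auto intro!: mult_right_mono)
    have "0 \<le> a * (norm s)\<^sup>2" "0 \<le> b * (norm (\<theta> - Theta))\<^sup>2" using a b by auto
    with s th a(2)[of s x] b(2)[of "\<theta> - Theta"]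
    show "min a b / 2 * (norm s)\<^sup>2 \<le> tracking_lyap x s \<theta>"
      "min a b / 2 * (norm (\<theta> - Theta))\<^sup>2 \<le> tracking_lyap x s \<theta>"
      unfolding tracking_lyap_def by auto
  qed
qed

lemma K_nonneg: "0 \<le> x \<bullet> (K *v x)"
  using K_pd by (cases "x = 0") (auto simp: pos_def_mat_def less_imp_le)

text \<open>By (P1) the forms \<open>M x\<close> are coercive with one constant for all
  \<open>x\<close>, so \<open>s\<close> and \<open>th\<close> are bounded before anything is known
  about \<open>q\<close> at later times or about the reference.\<close>

lemma tracking_uniform_bound:
  obtains R where "\<And>T r r' q qd th. T \<ge> 0 \<Longrightarrow> tracking_on {0..T} r r' q qd th \<Longrightarrow>
      q 0 = q0 \<Longrightarrow> qd 0 - r 0 = s0 \<Longrightarrow> th 0 = th0 \<Longrightarrow> norm (qd T - r T) \<le> R \<and> norm (th T) \<le> R"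
proof -
  obtain c where c: "c > 0" "\<And>x s \<theta>. c * (norm s)\<^sup>2 \<le> tracking_lyap x s \<theta>"
    "\<And>x s \<theta>. c * (norm (\<theta> - Theta))\<^sup>2 \<le> tracking_lyap x s \<theta>"
    using tracking_lyap_coercive by blast
  define V0 where "V0 = tracking_lyap q0 s0 th0"
  show thesis
  proof (rule that[of "norm Theta + sqrt (V0 / c)"])
    fix T :: real and r r' q qd th
    assume T: "T \<ge> 0" and tr: "tracking_on {0..T} r r' q qd th"
      and init: "q 0 = q0" "qd 0 - r 0 = s0" "th 0 = th0"
    have "tracking_lyap (q T) (qd T - r T) (th T) \<le> tracking_lyap (q 0) (qd 0 - r 0) (th 0)"
      by (rule nonincreasing_of_derivative[OF T tracking_lyap_derivative[OF tr]])
        (use K_nonneg in auto)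
    then have V: "tracking_lyap (q T) (qd T - r T) (th T) \<le> V0" by (simp add: V0_def init)
    have bd: "a \<le> sqrt (V0 / c)" if "c * a\<^sup>2 \<le> V0" for a
      using that c(1) by (intro real_le_rsqrt) (simp add: field_simps)
    have "norm (qd T - r T) \<le> sqrt (V0 / c)" "norm (th T - Theta) \<le> sqrt (V0 / c)"
      using bd order_trans[OF c(2) V] order_trans[OF c(3) V] by blast+
    moreover have "norm (th T) \<le> norm Theta + norm (th T - Theta)" by (rule norm_triangle_sub)
    moreover have "norm Theta \<ge> 0" by simp
    ultimately show "norm (qd T - r T) \<le> norm Theta + sqrt (V0 / c) \<and> norm (th T) \<le> norm Theta + sqrt (V0 / c)"
      by linarith
  qed
qed

lemma tracking_bounded:
  assumes "tracking_on {0..} r r' q qd th"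
  shows "bounded ((\<lambda>t. qd t - r t) ` {0..})" "bounded (th ` {0..})"
proof -
  obtain R where R: "\<And>T r' q' qd' th' r''. T \<ge> 0 \<Longrightarrow> tracking_on {0..T} r' r'' q' qd' th' \<Longrightarrow>
      q' 0 = q 0 \<Longrightarrow> qd' 0 - r' 0 = qd 0 - r 0 \<Longrightarrow> th' 0 = th 0 \<Longrightarrow> norm (qd' T - r' T) \<le> R \<and> norm (th' T) \<le> R"
    using tracking_uniform_bound[of "q 0" "qd 0 - r 0" "th 0"] by metis
  have "norm (qd T - r T) \<le> R \<and> norm (th T) \<le> R" if "T \<ge> 0" for T
    by (rule R[where r''=r']) (use that tracking_on_subset[OF assms] in auto)
  then show "bounded ((\<lambda>t. qd t - r t) ` {0..})" "bounded (th ` {0..})"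
    unfolding bounded_iff by (auto intro!: exI[of _ R])
qed

text \<open>Barbalat's lemma calls for a bounded derivative of \<open>s\<close>. The error dynamics
  express it through \<open>Cc\<close> and \<open>Y\<close>, whose boundedness along the trajectory
  comes from that of their arguments; hence the assumptions \<open>bdd\<close>.\<close>

theorem tracking_convergence:
  assumes tr: "tracking_on {0..} r r' q qd th"
    and bdd: "bounded (q ` {0..})" "bounded (qd ` {0..})" "bounded (r ` {0..})" "bounded (r' ` {0..})"
  shows "((\<lambda>t. qd t - r t) \<longlongrightarrow> 0) at_top"
proof -
  let ?s = "\<lambda>t. qd t - r t"
  have "\<exists>a. (qd has_vector_derivative a) (at t within {0..}) \<and>
        M (q t) *v a + Cc (q t) (qd t) *v qd t + G (q t)
          = - (K *v (qd t - r t)) + Y (q t) (qd t) (r' t) (r t) *v th t" if "t \<ge> 0" for t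
    using tr that by (auto simp: tracking_on_def)
  then obtain acc where acc: "\<And>t. t \<ge> 0 \<Longrightarrow> (qd has_vector_derivative acc t) (at t within {0..})"
    and eq: "\<And>t. t \<ge> 0 \<Longrightarrow> M (q t) *v acc t + Cc (q t) (qd t) *v qd t + G (q t)
          = - (K *v (qd t - r t)) + Y (q t) (qd t) (r' t) (r t) *v th t"
    by metis
  have s': "(?s has_vector_derivative acc t - r' t) (at t within {0..})" if "t \<ge> 0" for t
    by (rule has_vector_derivative_diff[OF acc[OF that]]) (use tr that in \<open>auto simp: tracking_on_def\<close>)
  note sb = tracking_bounded(1)[OF tr] and thb = tracking_bounded(2)[OF tr]
  have Cb: "bounded ((\<lambda>t. Cc (q t) (qd t)) ` {0..})"
    using bounded_image_continuous[OF Cc_cont bounded_image_Pair[OF bdd(1,2)]] by simp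
  have Yb: "bounded ((\<lambda>t. Y (q t) (qd t) (r' t) (r t)) ` {0..})"
    using bounded_image_continuous[OF Y_cont bounded_image_Pair[OF bdd(1) bounded_image_Pair[OF bdd(2)
        bounded_image_Pair[OF bdd(4,3)]]]] by simp
  let ?f = "\<lambda>t. Y (q t) (qd t) (r' t) (r t) *v (th t - Theta) - K *v ?s t - Cc (q t) (qd t) *v ?s t"
  have "bounded (?f ` {0..})"
    by (intro bounded_minus_comp bounded_image_bilinear[OF bounded_bilinear_matrix_vector_mult]
        bounded_image_const sb thb Cb Yb)
  then obtain F where F: "\<And>t. t \<ge> 0 \<Longrightarrow> norm (?f t) \<le> F" by (force simp: bounded_iff)
  obtain c where c: "c > 0" "\<And>x y. c * (norm y)\<^sup>2 \<le> y \<bullet> (M x *v y)" using M_pd by blast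
  have "norm (acc t - r' t) \<le> F / c" if "t \<ge> 0" for t
  proof -
    have "norm (acc t - r' t) \<le> norm (M (q t) *v (acc t - r' t)) / c"
      by (rule coercive_norm_le[OF c(1) c(2)])
    also have "\<dots> \<le> F / c"
      using F[OF that] c(1) unfolding tracking_error_dynamics[OF eq[OF that]] by (intro divide_right_mono) auto
    finally show ?thesis .
  qed
  then have ab: "bounded ((\<lambda>t. acc t - r' t) ` {0..})" unfolding bounded_iff by (auto intro!: exI[of _ "F / c"])
  let ?g = "\<lambda>t. ?s t \<bullet> (K *v ?s t)" and ?g' = "\<lambda>t. ?s t \<bullet> (K *v (acc t - r' t)) + (acc t - r' t) \<bullet> (K *v ?s t)"
  have "bounded (?g' ` {0..})"
    by (intro bounded_plus_comp bounded_image_bilinear[OF bounded_bilinear_inner]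
        bounded_image_bilinear[OF bounded_bilinear_matrix_vector_mult] bounded_image_const sb ab)
  then obtain L where L: "\<And>t. t \<ge> 0 \<Longrightarrow> \<bar>?g' t\<bar> \<le> L" by (force simp: bounded_iff)
  have g: "(?g \<longlongrightarrow> 0) at_top"
  proof (rule Lyapunov_Barbalat[where V="\<lambda>t. tracking_lyap (q t) (?s t) (th t)" and g'="?g'" and L=L])
    fix t :: real assume t: "t \<ge> 0"
    show "((\<lambda>t. tracking_lyap (q t) (?s t) (th t)) has_vector_derivative - ?g t) (at t within {0..})"
      by (rule tracking_lyap_derivative[OF tr]) (use t in simp)
    have "(?g has_vector_derivative ?s t \<bullet> (K *v (acc t - r' t) + 0 *v ?s t) + (acc t - r' t) \<bullet> (K *v ?s t)) (at t within {0..})"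
      by (intro bounded_bilinear.has_vector_derivative[OF bounded_bilinear_inner]
        bounded_bilinear.has_vector_derivative[OF bounded_bilinear_matrix_vector_mult] s' t has_vector_derivative_const)
    then show "(?g has_vector_derivative ?g' t) (at t within {0..})" by simp
    show "\<bar>?g' t\<bar> \<le> L" by (rule L[OF t])
    obtain b where b: "b > 0" "\<And>x s \<theta>. b * (norm s)\<^sup>2 \<le> tracking_lyap x s \<theta>"
      "\<And>x s \<theta>. b * (norm (\<theta> - Theta))\<^sup>2 \<le> tracking_lyap x s \<theta>"
      using tracking_lyap_coercive by blast
    from b(1) have "0 \<le> b * (norm (?s t))\<^sup>2" by simp
    then show "0 \<le> tracking_lyap (q t) (?s t) (th t)" by (rule order_trans[OF _ b(2)])
    show "0 \<le> ?g t" by (rule K_nonneg)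
  qed
  obtain k where k: "k > 0" "\<And>x. k * (norm x)\<^sup>2 \<le> x \<bullet> (K *v x)"
    using positive_form_coercive[of K] K_pd unfolding pos_def_mat_def by metis
  have "((\<lambda>t. sqrt (?g t / k)) \<longlongrightarrow> sqrt (0 / k)) at_top"
    using k(1) by (intro tendsto_real_sqrt tendsto_divide g tendsto_const) auto
  then have "((\<lambda>t. sqrt (?g t / k)) \<longlongrightarrow> 0) at_top" by simp
  then show ?thesis
  proof (rule Lim_null_comparison[rotated], intro always_eventually allI)
    fix t show "norm (?s t) \<le> sqrt (?g t / k)"
      using k(2)[of "?s t"] k(1) by (intro real_le_rsqrt) (simp add: field_simps)
  qed
qed

end

section \<open>The closed-loop network\<close>

locale el_network = observer_network N E mu1 mu2 om0
  for N E mu1 mu2 and om0 :: "real^'l::finite" +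
  fixes M :: "nat \<Rightarrow> real^'n \<Rightarrow> real^'n^'n" and DM :: "nat \<Rightarrow> real^'n \<Rightarrow> real^'n \<Rightarrow> real^'n^'n"
    and Cc :: "nat \<Rightarrow> real^'n \<Rightarrow> real^'n \<Rightarrow> real^'n^'n" and G :: "nat \<Rightarrow> real^'n \<Rightarrow> real^'n"
    and Y :: "nat \<Rightarrow> real^'n \<Rightarrow> real^'n \<Rightarrow> real^'n \<Rightarrow> real^'n \<Rightarrow> real^'p^'n" and Theta :: "nat \<Rightarrow> real^'p"
    and K :: "nat \<Rightarrow> real^'n^'n" and Lam :: "nat \<Rightarrow> real^'p^'p"
    and Cm :: "real^('l \<times> half)^'n" and alpha :: real
  assumes follower: "\<And>i. i \<in> {1..N} \<Longrightarrow>
      euler_lagrange (M i) (DM i) (Cc i) (G i) (Y i) (Theta i) (K i) (Lam i)"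
    and G_cont: "\<And>i. i \<in> {1..N} \<Longrightarrow> continuous_on UNIV (G i)"
    and alpha_pos: "alpha > 0"
begin

definition ref_vel :: "real^('l \<times> half) \<Rightarrow> real^'l \<Rightarrow> real^'n \<Rightarrow> real^'n" where
  "ref_vel h w x = Cm *v (Smat w *v h) - alpha *\<^sub>R (x - Cm *v h)"

definition ref_acc :: "real^('l \<times> half) \<Rightarrow> real^'l \<Rightarrow> real^('l \<times> half) \<Rightarrow> real^'l \<Rightarrow> real^'n \<Rightarrow> real^'n" where
  "ref_acc h w h' w' xd = Cm *v (Smat w *v h') + Cm *v (Smat w' *v h) - alpha *\<^sub>R (xd - Cm *v h')"

definition network_on where
  "network_on J h w q qd th \<longleftrightarrow> observer_on J h w \<and> (\<forall>i\<in>{1..N}.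
     euler_lagrange.tracking_on (M i) (Cc i) (G i) (Y i) (K i) (Lam i) J
       (\<lambda>t. ref_vel (h i t) (w i t) (q i t))
       (\<lambda>t. ref_acc (h i t) (w i t) (eta_rate (\<lambda>j. h j t) (\<lambda>j. w j t) i) (om_rate (\<lambda>j. h j t) i) (qd i t))
       (q i) (qd i) (th i))"

lemma network_on_subset: "network_on J h w q qd th \<Longrightarrow> I \<subseteq> J \<Longrightarrow> network_on I h w q qd th"
  unfolding network_on_def
  using euler_lagrange.tracking_on_subset[OF follower] observer_on_subset by blast

text \<open>\<open>tracking_on\<close> demands a differentiable reference. The product rule for the
  bilinear map \<open>Smat w *v h\<close> provides it, and \<open>ref_acc\<close> splits the
  resulting sum as the control law does.\<close>

lemma ref_vel_has_vector_derivative: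
  assumes "(h has_vector_derivative h') (at t within J)" "(w has_vector_derivative w') (at t within J)"
    "(x has_vector_derivative x') (at t within J)"
  shows "((\<lambda>t. ref_vel (h t) (w t) (x t)) has_vector_derivative ref_acc (h t) (w t) h' w' x') (at t within J)"
proof -
  note C = bounded_linear.has_vector_derivative[OF matrix_vector_mul_bounded_linear, of _ _ _ Cm]
  have "((\<lambda>t. ref_vel (h t) (w t) (x t)) has_vector_derivative
      Cm *v (Smat (w t) *v h' + Smat w' *v h t) - alpha *\<^sub>R (x' - Cm *v h')) (at t within J)"
    unfolding ref_vel_def
    by (intro has_vector_derivative_diff C bounded_bilinear.has_vector_derivative[OF bounded_bilinear_Smat]
        bounded_linear.has_vector_derivative[OF bounded_linear_scaleR_right] assms)
  then show ?thesis by (simp add: ref_acc_def matrix_vector_right_distrib)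
qed

text \<open>A regrouping of clauses with the leader moved to index 0, except for one:
  differentiability of the reference is part of \<open>tracking_on\<close> but absent from
  \<open>closed_loop\<close>, and has to be derived from the other equations.\<close>

lemma closed_loop_iff_network_on:
  "closed_loop N E M Cc G Y K Lam Cm alpha mu1 mu2 om0 v q qd eta om th \<longleftrightarrow>
   network_on {0..} (\<lambda>i. if i = 0 then v else eta i) om q qd th"
proof -
  define h where "h = (\<lambda>i. if i = 0 then v else eta i)"
  have hv: "h 0 = v" and he: "\<And>i. i \<noteq> 0 \<Longrightarrow> h i = eta i" by (auto simp: h_def)
  have dis: "(\<Sum>j\<in>nbrs N E i. (if j = 0 then v t else eta j t) - eta i t) = disagreement N E (\<lambda>j. h j t) i"
    if "i \<in> {1..N}" for i t
    unfolding disagreement_def using that by (intro sum.cong) (auto simp: h_def)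
  let ?er = "\<lambda>i t. eta_rate (\<lambda>j. h j t) (\<lambda>j. om j t) i" and ?or = "\<lambda>i t. om_rate (\<lambda>j. h j t) i"
  let ?r = "\<lambda>i t. ref_vel (h i t) (om i t) (q i t)"
  let ?r' = "\<lambda>i t. ref_acc (h i t) (om i t) (?er i t) (?or i t) (qd i t)"
  let ?acc = "\<lambda>i t. \<exists>acc. (qd i has_vector_derivative acc) (at t within {0..}) \<and>
        M i (q i t) *v acc + Cc i (q i t) (qd i t) *v qd i t + G i (q i t)
          = - (K i *v (qd i t - ?r i t)) + Y i (q i t) (qd i t) (?r' i t) (?r i t) *v th i t"
  let ?th = "\<lambda>i t. (th i has_vector_derivative
        - (matrix_inv (Lam i) *v (transpose (Y i (q i t) (qd i t) (?r' i t) (?r i t)) *v (qd i t - ?r i t)))) (at t within {0..})"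
  have "closed_loop N E M Cc G Y K Lam Cm alpha mu1 mu2 om0 v q qd eta om th \<longleftrightarrow>
    (\<forall>t\<ge>0. (h 0 has_vector_derivative ?er 0 t) (at t within {0..})) \<and>
    (\<forall>i\<in>{1..N}. \<forall>t\<ge>0. (q i has_vector_derivative qd i t) (at t within {0..}) \<and> ?acc i t \<and>
        (h i has_vector_derivative ?er i t) (at t within {0..}) \<and>
        (om i has_vector_derivative ?or i t) (at t within {0..}) \<and> ?th i t)"
    (is "_ \<longleftrightarrow> ?lead \<and> ?fol")
    unfolding closed_loop_def Let_def
  proof (rule arg_cong2[where f="(\<and>)"], goal_cases)
    case 1
    show ?case by (simp add: hv eta_rate_def)
  next
    case 2
    show ?case
    proof (intro ball_cong[OF refl] all_cong, goal_cases)
      case (1 i t)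
      note i = 1(1)
      then have "i \<noteq> 0" by simp
      then have er: "?er i t = Smat (om i t) *v eta i t + mu1 *\<^sub>R disagreement N E (\<lambda>j. h j t) i"
        and orr: "?or i t = mu2 *\<^sub>R (phi (disagreement N E (\<lambda>j. h j t) i) *v eta i t)"
        by (simp_all add: eta_rate_def om_rate_def he)
      show ?case
        unfolding dis[OF i] er orr ref_vel_def ref_acc_def he[OF \<open>i \<noteq> 0\<close>] by (rule refl)
    qed
  qed
  also have "?lead \<and> ?fol \<longleftrightarrow> network_on {0..} h om q qd th"
  proof
    assume R: "?lead \<and> ?fol"
    have eta: "(h i has_vector_derivative ?er i t) (at t within {0..})" if "i \<le> N" "t \<ge> 0" for i t
      using R that by (cases "i = 0") auto
    have om: "(om i has_vector_derivative ?or i t) (at t within {0..})" if "i \<in> {1..N}" "t \<ge> 0" for i t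
      using R that by auto
    have pl: "(q i has_vector_derivative qd i t) (at t within {0..})" "?acc i t" "?th i t" if "i \<in> {1..N}" "t \<ge> 0" for i t using R that by blast+
    have "(?r i has_vector_derivative ?r' i t) (at t within {0..})" if "i \<in> {1..N}" "t \<ge> 0" for i t
      by (rule ref_vel_has_vector_derivative) (use eta om pl that in auto)
    with eta om pl show "network_on {0..} h om q qd th"
      unfolding network_on_def observer_on_def
      by (simp add: euler_lagrange.tracking_on_def[OF follower] del: transpose_matrix_vector)
  next
    assume "network_on {0..} h om q qd th"
    then show "?lead \<and> ?fol" unfolding network_on_def observer_on_def
      by (simp add: euler_lagrange.tracking_on_def[OF follower] del: transpose_matrix_vector)
  qed
  finally show ?thesis unfolding h_def .
qed

text \<open>The bounded expression is \<open>ref_vel\<close> stripped of its position term. Since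
  \<open>qd\<close> is \<open>s\<close> plus \<open>ref_vel\<close>, the position obeys a filter
  whose input is \<open>s\<close> plus this expression.\<close>

lemma ref_vel_norm_bound:
  obtains B where "B \<ge> 0" "\<And>h w. norm h \<le> R \<Longrightarrow> norm w \<le> R \<Longrightarrow> norm (Cm *v (Smat w *v h) + alpha *\<^sub>R (Cm *v h)) \<le> B"
proof -
  obtain KC where KC: "KC > 0" "\<And>x. norm (Cm *v x) \<le> norm x * KC"
    using bounded_linear.pos_bounded[OF matrix_vector_mul_bounded_linear[of Cm]] by blast
  obtain KS where KS: "KS > 0" "\<And>z (x :: real^('l \<times> half)). norm (Smat z *v x) \<le> norm z * norm x * KS"
    using bounded_bilinear.pos_bounded[OF bounded_bilinear_Smat] by blast
  \<comment> \<open>A negative \<open>R\<close> would spoil the monotonicity of the products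
    below.\<close>
  define R' where "R' = max R 0"
  show thesis
  proof (rule that[of "R' * R' * KS * KC + alpha * (R' * KC)"])
    show "0 \<le> R' * R' * KS * KC + alpha * (R' * KC)" using KC KS alpha_pos by (simp add: R'_def)
    fix h :: "real^('l \<times> half)" and w :: "real^'l" assume "norm h \<le> R" "norm w \<le> R"
    then have hw: "norm h \<le> R'" "norm w \<le> R'" by (auto simp: R'_def)
    have "norm w * norm h * KS \<le> R' * R' * KS"
      using hw KS(1) by (intro mult_right_mono mult_mono) (auto simp: R'_def)
    then have "norm (Smat w *v h) \<le> R' * R' * KS" using KS(2)[of w h] by linarith
    then have "norm (Smat w *v h) * KC \<le> R' * R' * KS * KC" using KC(1) by (intro mult_right_mono) auto
    then have 1: "norm (Cm *v (Smat w *v h)) \<le> R' * R' * KS * KC" using KC(2)[of "Smat w *v h"] by linarith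
    have "norm h * KC \<le> R' * KC" using hw KC(1) by (intro mult_right_mono) auto
    then have "norm (Cm *v h) \<le> R' * KC" using KC(2)[of h] by linarith
    then have 2: "norm (alpha *\<^sub>R (Cm *v h)) \<le> alpha * (R' * KC)" using alpha_pos by simp
    show "norm (Cm *v (Smat w *v h) + alpha *\<^sub>R (Cm *v h)) \<le> R' * R' * KS * KC + alpha * (R' * KC)"
      using norm_triangle_ineq[of "Cm *v (Smat w *v h)" "alpha *\<^sub>R (Cm *v h)"] 1 2 by linarith
  qed
qed

text \<open>The cascade is unwound in order: observer, then \<open>s\<close> and \<open>th\<close>,
  then \<open>q\<close> by the filter \<open>q' = u - alpha q\<close>, and finally \<open>qd\<close>
  from the same equation.\<close>

lemma network_uniform_bound:
  obtains R where "\<And>T h w q qd th. T \<ge> 0 \<Longrightarrow> network_on {0..T} h w q qd th \<Longrightarrow>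
      (\<And>i. i \<le> N \<Longrightarrow> h i 0 = h0 i) \<Longrightarrow>
      (\<And>i. i \<in> {1..N} \<Longrightarrow> w i 0 = w0 i \<and> q i 0 = q0 i \<and> qd i 0 = qd0 i \<and> th i 0 = th0 i) \<Longrightarrow>
      (\<forall>i\<le>N. norm (h i T) \<le> R) \<and>
      (\<forall>i\<in>{1..N}. norm (w i T) \<le> R \<and> norm (q i T) \<le> R \<and> norm (qd i T) \<le> R \<and> norm (th i T) \<le> R)"
proof -
  obtain R1 where R1: "\<And>T h w. T \<ge> 0 \<Longrightarrow> observer_on {0..T} h w \<Longrightarrow> (\<And>i. i \<le> N \<Longrightarrow> h i 0 = h0 i) \<Longrightarrow>
      (\<And>i. i \<in> {1..N} \<Longrightarrow> w i 0 = w0 i) \<Longrightarrow>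
      (\<forall>i\<le>N. norm (h i T) \<le> R1) \<and> (\<forall>i\<in>{1..N}. norm (w i T) \<le> R1)"
    using observer_uniform_bound by blast
  let ?tr = "\<lambda>i. euler_lagrange.tracking_on (M i) (Cc i) (G i) (Y i) (K i) (Lam i)"
  have "\<exists>R. \<forall>T r r' q qd th. T \<ge> 0 \<longrightarrow> ?tr i {0..T} r r' q qd th \<longrightarrow>
      q 0 = q0 i \<longrightarrow> qd 0 - r 0 = qd0 i - ref_vel (h0 i) (w0 i) (q0 i) \<longrightarrow> th 0 = th0 i \<longrightarrow>
      norm (qd T - r T) \<le> R \<and> norm (th T) \<le> R" if "i \<in> {1..N}" for i
    by (rule euler_lagrange.tracking_uniform_bound[OF follower[OF that],
          of "q0 i" "qd0 i - ref_vel (h0 i) (w0 i) (q0 i)" "th0 i"]) blast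
  then obtain R2 where R2: "\<And>i T r r' q qd th. i \<in> {1..N} \<Longrightarrow> T \<ge> 0 \<Longrightarrow> ?tr i {0..T} r r' q qd th \<Longrightarrow>
      q 0 = q0 i \<Longrightarrow> qd 0 - r 0 = qd0 i - ref_vel (h0 i) (w0 i) (q0 i) \<Longrightarrow> th 0 = th0 i \<Longrightarrow>
      norm (qd T - r T) \<le> R2 i \<and> norm (th T) \<le> R2 i"
    by metis
  obtain B where B: "B \<ge> 0" "\<And>h w. norm h \<le> R1 \<Longrightarrow> norm w \<le> R1 \<Longrightarrow> norm (Cm *v (Smat w *v h) + alpha *\<^sub>R (Cm *v h)) \<le> B"
    using ref_vel_norm_bound by blast
  \<comment> \<open>The filter's bound: initial position plus input bound over \<open>alpha\<close>.
    Absolute values are taken because the sign of \<open>R2 i\<close> is not known.\<close>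
  define Q where "Q i = norm (q0 i) + (\<bar>R2 i\<bar> + B) / alpha" for i
  define R where "R = \<bar>R1\<bar> + (\<Sum>i=1..N. Q i + \<bar>R2 i\<bar> + B + alpha * Q i)"
  have Q: "Q i \<ge> 0" for i using B alpha_pos by (simp add: Q_def)
  have Ri: "\<bar>R1\<bar> + (Q i + \<bar>R2 i\<bar> + B + alpha * Q i) \<le> R" if "i \<in> {1..N}" for i
    unfolding R_def using that Q B(1) alpha_pos
    by (intro add_left_mono member_le_sum[where f="\<lambda>i. Q i + \<bar>R2 i\<bar> + B + alpha * Q i"]) auto
  have "0 \<le> (\<Sum>i=1..N. Q i + \<bar>R2 i\<bar> + B + alpha * Q i)"
    using Q B(1) alpha_pos by (intro sum_nonneg) auto
  then have RR1: "R1 \<le> R" unfolding R_def using abs_ge_self[of R1] by linarith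
  show thesis
  proof (rule that[of R])
    fix T h w q qd th
    assume T: "(T::real) \<ge> 0" and net: "network_on {0..T} h w q qd th"
      and ih: "\<And>i. i \<le> N \<Longrightarrow> h i 0 = h0 i"
      and init: "\<And>i. i \<in> {1..N} \<Longrightarrow> w i 0 = w0 i \<and> q i 0 = q0 i \<and> qd i 0 = qd0 i \<and> th i 0 = th0 i"
    \<comment> \<open>The filter integrates its input over all of \<open>{0..T}\<close>, so the
      bounds, which speak of the final time, are applied to restrictions to
      \<open>{0..t}\<close>.\<close>
    have obs: "(\<forall>i\<le>N. norm (h i t) \<le> R1) \<and> (\<forall>i\<in>{1..N}. norm (w i t) \<le> R1)" if "t \<in> {0..T}" for t
    proof (rule R1)
      show "observer_on {0..t} h w"
        using network_on_subset[OF net, of "{0..t}"] that by (auto simp: network_on_def)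
    qed (use that ih init in auto)
    have "norm (w i T) \<le> R \<and> norm (q i T) \<le> R \<and> norm (qd i T) \<le> R \<and> norm (th i T) \<le> R" if i: "i \<in> {1..N}" for i
    proof -
      let ?r = "\<lambda>t. ref_vel (h i t) (w i t) (q i t)"
      have iN: "i \<le> N" using i by simp
      have tr: "norm (qd i t - ?r t) \<le> R2 i \<and> norm (th i t) \<le> R2 i" if t: "t \<in> {0..T}" for t
      proof (rule R2[OF i])
        show "?tr i {0..t} ?r (\<lambda>t. ref_acc (h i t) (w i t) (eta_rate (\<lambda>j. h j t) (\<lambda>j. w j t) i)
            (om_rate (\<lambda>j. h j t) i) (qd i t)) (q i) (qd i) (th i)"
          using network_on_subset[OF net, of "{0..t}"] t i by (auto simp: network_on_def)
      qed (use t ih[OF iN] init[OF i] in auto)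
      let ?u = "\<lambda>t. (qd i t - ?r t) + (Cm *v (Smat (w i t) *v h i t) + alpha *\<^sub>R (Cm *v h i t))"
      have qd: "qd i t = ?u t - alpha *\<^sub>R q i t" for t
        by (simp add: ref_vel_def algebra_simps)
      have ub: "norm (?u t) \<le> \<bar>R2 i\<bar> + B" if t: "t \<in> {0..T}" for t
      proof -
        have "norm (Cm *v (Smat (w i t) *v h i t) + alpha *\<^sub>R (Cm *v h i t)) \<le> B"
          using obs[OF t] i iN by (intro B(2)) auto
        moreover have "norm (qd i t - ?r t) \<le> \<bar>R2 i\<bar>" using tr[OF t] by linarith
        ultimately show ?thesis
          using norm_triangle_ineq[of "qd i t - ?r t" "Cm *v (Smat (w i t) *v h i t) + alpha *\<^sub>R (Cm *v h i t)"]
          by linarith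
      qed
      have "norm (q i T) \<le> exp (- alpha * (T - 0)) * norm (q i 0) + (\<bar>R2 i\<bar> + B) / alpha"
      proof (rule stable_filter_bound[OF T alpha_pos, where u="?u"])
        fix t assume t: "t \<in> {0..T}"
        have "(q i has_vector_derivative qd i t) (at t within {0..T})"
          using net i t unfolding network_on_def by (simp add: euler_lagrange.tracking_on_def[OF follower])
        then show "(q i has_vector_derivative ?u t - alpha *\<^sub>R q i t) (at t within {0..T})"
          unfolding qd[symmetric] .
        show "norm (?u t) \<le> \<bar>R2 i\<bar> + B" by (rule ub[OF t])
      qed
      moreover have "exp (- alpha * (T - 0)) * norm (q i 0) \<le> 1 * norm (q i 0)"
        using alpha_pos T by (intro mult_right_mono) auto
      ultimately have q: "norm (q i T) \<le> Q i" using init[OF i] by (simp add: Q_def)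
      have TT: "T \<in> {0..T}" using T by simp
      have "norm (qd i T) = norm (?u T - alpha *\<^sub>R q i T)"
        using qd[of T] by (rule arg_cong)
      also have "\<dots> \<le> norm (?u T) + norm (alpha *\<^sub>R q i T)" by (rule norm_triangle_ineq4)
      also have "norm (alpha *\<^sub>R q i T) \<le> alpha * Q i" using q alpha_pos by simp
      finally have qdT: "norm (qd i T) \<le> (\<bar>R2 i\<bar> + B) + alpha * Q i" using ub[OF TT] by linarith
      have "0 \<le> alpha * Q i" using alpha_pos Q by simp
      with Ri[OF i] q qdT Q[of i] B(1) tr[OF TT] obs[OF TT] i show ?thesis
        by (smt (verit) abs_ge_self abs_ge_zero)
    qed
    moreover have "norm (h i T) \<le> R" if "i \<le> N" for i
      using obs[of T] T that RR1 by fastforce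
    ultimately show "(\<forall>i\<le>N. norm (h i T) \<le> R) \<and>
      (\<forall>i\<in>{1..N}. norm (w i T) \<le> R \<and> norm (q i T) \<le> R \<and> norm (qd i T) \<le> R \<and> norm (th i T) \<le> R)"
      by blast
  qed
qed

lemma network_bounded:
  assumes net: "network_on {0..} h w q qd th" and i: "i \<in> {1..N}"
  shows "bounded (h i ` {0..})" "bounded (w i ` {0..})" "bounded (q i ` {0..})" "bounded (qd i ` {0..})"
    "bounded (th i ` {0..})"
proof -
  obtain R where R: "\<And>T h' w' q' qd' th'. T \<ge> 0 \<Longrightarrow> network_on {0..T} h' w' q' qd' th' \<Longrightarrow>
      (\<And>i. i \<le> N \<Longrightarrow> h' i 0 = h i 0) \<Longrightarrow>
      (\<And>i. i \<in> {1..N} \<Longrightarrow> w' i 0 = w i 0 \<and> q' i 0 = q i 0 \<and> qd' i 0 = qd i 0 \<and> th' i 0 = th i 0) \<Longrightarrow>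
      (\<forall>i\<le>N. norm (h' i T) \<le> R) \<and>
      (\<forall>i\<in>{1..N}. norm (w' i T) \<le> R \<and> norm (q' i T) \<le> R \<and> norm (qd' i T) \<le> R \<and> norm (th' i T) \<le> R)"
    using network_uniform_bound[of "\<lambda>i. h i 0" "\<lambda>i. w i 0" "\<lambda>i. q i 0" "\<lambda>i. qd i 0" "\<lambda>i. th i 0"] by blast
  have "(\<forall>i\<le>N. norm (h i T) \<le> R) \<and>
      (\<forall>i\<in>{1..N}. norm (w i T) \<le> R \<and> norm (q i T) \<le> R \<and> norm (qd i T) \<le> R \<and> norm (th i T) \<le> R)" if "T \<ge> 0" for T
    by (rule R) (use that network_on_subset[OF net] in auto)
  with i have "norm (h i T) \<le> R \<and> norm (w i T) \<le> R \<and> norm (q i T) \<le> R \<and> norm (qd i T) \<le> R \<and> norm (th i T) \<le> R"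
    if "T \<ge> 0" for T using that by force
  then show "bounded (h i ` {0..})" "bounded (w i ` {0..})" "bounded (q i ` {0..})" "bounded (qd i ` {0..})"
    "bounded (th i ` {0..})"
    unfolding bounded_iff by (auto intro!: exI[of _ R])
qed

theorem network_tracks_leader:
  assumes net: "network_on {0..} h w q qd th" and i: "i \<in> {1..N}"
  shows "((\<lambda>t. q i t - Cm *v h 0 t) \<longlongrightarrow> 0) at_top"
    and "((\<lambda>t. qd i t - Cm *v (Smat om0 *v h 0 t)) \<longlongrightarrow> 0) at_top"
proof -
  interpret el: euler_lagrange "M i" "DM i" "Cc i" "G i" "Y i" "Theta i" "K i" "Lam i"
    by (rule follower[OF i])
  have iN: "i \<le> N" "i \<noteq> 0" using i by auto
  have obs: "observer_on {0..} h w" using net by (simp add: network_on_def)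
  let ?er = "\<lambda>t. eta_rate (\<lambda>j. h j t) (\<lambda>j. w j t) i" and ?or = "\<lambda>t. om_rate (\<lambda>j. h j t) i"
  let ?r = "\<lambda>t. ref_vel (h i t) (w i t) (q i t)" and ?r' = "\<lambda>t. ref_acc (h i t) (w i t) (?er t) (?or t) (qd i t)"
  let ?e = "\<lambda>t. disagreement N E (\<lambda>j. h j t) i"
  have tr: "el.tracking_on {0..} ?r ?r' (q i) (qd i) (th i)" using net i by (simp add: network_on_def)
  note b = network_bounded[OF net i] and rb = observer_rates_bounded(1)[OF obs iN(1)] observer_rates_bounded(2)[OF obs i]
  have "bounded (?r ` {0..})" unfolding ref_vel_def
    by (intro bounded_minus_comp bounded_scaleR_comp bounded_image_bilinear[OF bounded_bilinear_Smat]
      bounded_image_bilinear[OF bounded_bilinear_matrix_vector_mult] bounded_image_const b)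
  moreover have "bounded (?r' ` {0..})" unfolding ref_acc_def
    by (intro bounded_minus_comp bounded_plus_comp bounded_scaleR_comp bounded_image_bilinear[OF bounded_bilinear_Smat]
      bounded_image_bilinear[OF bounded_bilinear_matrix_vector_mult] bounded_image_const b rb)
  ultimately have s0: "((\<lambda>t. qd i t - ?r t) \<longlongrightarrow> 0) at_top"
    by (intro el.tracking_convergence[OF tr] b)
  note conv = observer_convergence[OF obs i]
  have Clim: "((\<lambda>t. Cm *v x t) \<longlongrightarrow> 0) at_top" if "(x \<longlongrightarrow> 0) at_top" for x
    using bounded_linear.tendsto_zero[OF matrix_vector_mul_bounded_linear that] .
  let ?u = "\<lambda>t. (qd i t - ?r t) - mu1 *\<^sub>R (Cm *v ?e t)" and ?z = "\<lambda>t. q i t - Cm *v h i t"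
  have u0: "(?u \<longlongrightarrow> 0) at_top"
    using tendsto_diff[OF s0 tendsto_scaleR[OF tendsto_const Clim[OF conv(1)]], of mu1] by simp
  \<comment> \<open>The terms with \<open>Smat (w i t)\<close> in \<open>ref_vel\<close> and in the
    rate of \<open>h i\<close> cancel; this is why the unknown frequency leaves no trace in the
    filter.\<close>
  have z': "?u t - alpha *\<^sub>R ?z t = qd i t - Cm *v ?er t" for t
    using iN by (simp add: eta_rate_def ref_vel_def matrix_vector_right_distrib matrix_vector_mult_scaleR)
  have z0: "(?z \<longlongrightarrow> 0) at_top"
  proof (rule stable_filter_tendsto[OF alpha_pos _ u0])
    fix t :: real assume t: "t \<ge> 0"
    have "(q i has_vector_derivative qd i t) (at t within {0..})"
      using tr t by (auto simp: el.tracking_on_def)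
    moreover have "(h i has_vector_derivative ?er t) (at t within {0..})"
      using obs t iN by (auto simp: observer_on_def)
    ultimately show "(?z has_vector_derivative ?u t - alpha *\<^sub>R ?z t) (at t within {0..})"
      unfolding z' by (intro has_vector_derivative_diff bounded_linear.has_vector_derivative[OF matrix_vector_mul_bounded_linear])
  qed
  from tendsto_add[OF z0 Clim[OF conv(2)]]
  show "((\<lambda>t. q i t - Cm *v h 0 t) \<longlongrightarrow> 0) at_top"
    by (simp add: matrix_vector_mult_diff_distrib)
  \<comment> \<open>Read backwards, the filter identity yields the velocity: both of its terms
    vanish, hence so does \<open>qd i\<close> minus the rate of \<open>Cm *v h i t\<close>.\<close>
  have "((\<lambda>t. ?u t - alpha *\<^sub>R ?z t) \<longlongrightarrow> 0) at_top"
    using tendsto_diff[OF u0 tendsto_scaleR[OF tendsto_const z0], of alpha] by simp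
  from tendsto_add[OF this[unfolded z'] Clim[OF conv(3)]]
  show "((\<lambda>t. qd i t - Cm *v (Smat om0 *v h 0 t)) \<longlongrightarrow> 0) at_top"
    by (simp add: matrix_vector_mult_diff_distrib)
qed

section \<open>Existence of closed-loop trajectories\<close>

text \<open>The state of node \<open>i\<close> is \<open>(\<eta>\<^sub>i, \<omega>\<^sub>i, q\<^sub>i, q\<^sub>i', \<theta>\<^sub>i)\<close>. The leader is node 0, with \<open>v\<close> in the first component
  and the other four frozen at 0; so are all nodes beyond \<open>N\<close>.\<close>

definition closed_loop_field ::
    "(nat \<Rightarrow> (real^('l \<times> half)) \<times> (real^'l) \<times> (real^'n) \<times> (real^'n) \<times> (real^'p)) \<Rightarrow>
     nat \<Rightarrow> (real^('l \<times> half)) \<times> (real^'l) \<times> (real^'n) \<times> (real^'n) \<times> (real^'p)" where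
  "closed_loop_field x i =
    (let h = (\<lambda>j. fst (x j)); w = (\<lambda>j. fst (snd (x j)));
         q = fst (snd (snd (x i))); qd = fst (snd (snd (snd (x i)))); th = snd (snd (snd (snd (x i))));
         r = ref_vel (h i) (w i) q;
         Yi = Y i q qd (ref_acc (h i) (w i) (eta_rate h w i) (om_rate h i) qd) r
     in if i = 0 then (eta_rate h w 0, 0)
        else if i \<le> N then
          (eta_rate h w i, om_rate h i, qd,
           matrix_inv (M i q) *v (- (K i *v (qd - r)) + Yi *v th - Cc i q qd *v qd - G i q),
           - (matrix_inv (Lam i) *v (transpose Yi *v (qd - r))))
        else 0)"

text \<open>The delicate entry is the acceleration, where the inverse of \<open>M i\<close> varies
  with the state; uniform coercivity of \<open>M i\<close> settles it.\<close>

lemma continuous_closed_loop_field: "continuous_on UNIV (\<lambda>x. closed_loop_field x i)"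
proof -
  note mult = bounded_bilinear.continuous_on[OF bounded_bilinear_matrix_vector_mult]
    bounded_bilinear.continuous_on[OF bounded_bilinear_Smat]
    bounded_bilinear.continuous_on[OF bounded_bilinear_phi]
  let ?h = "\<lambda>(x :: nat \<Rightarrow> (real^('l \<times> half)) \<times> (real^'l) \<times> (real^'n) \<times> (real^'n) \<times> (real^'p)) j. fst (x j)"
    and ?w = "\<lambda>(x :: nat \<Rightarrow> (real^('l \<times> half)) \<times> (real^'l) \<times> (real^'n) \<times> (real^'n) \<times> (real^'p)) j. fst (snd (x j))"
  let ?q = "\<lambda>(x :: nat \<Rightarrow> (real^('l \<times> half)) \<times> (real^'l) \<times> (real^'n) \<times> (real^'n) \<times> (real^'p)). fst (snd (snd (x i)))"
    and ?qd = "\<lambda>(x :: nat \<Rightarrow> (real^('l \<times> half)) \<times> (real^'l) \<times> (real^'n) \<times> (real^'n) \<times> (real^'p)). fst (snd (snd (snd (x i))))"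
    and ?th = "\<lambda>(x :: nat \<Rightarrow> (real^('l \<times> half)) \<times> (real^'l) \<times> (real^'n) \<times> (real^'n) \<times> (real^'p)). snd (snd (snd (snd (x i))))"
  have h: "continuous_on UNIV (\<lambda>x. ?h x j)" and w: "continuous_on UNIV (\<lambda>x. ?w x j)"
    and q: "continuous_on UNIV ?q" and qd: "continuous_on UNIV ?qd" and th: "continuous_on UNIV ?th" for j
    by (intro continuous_on_fst continuous_on_snd continuous_on_product_coordinates)+
  have dis: "continuous_on UNIV (\<lambda>x. disagreement N E (?h x) j)" for j
    unfolding disagreement_def by (intro continuous_on_sum continuous_on_diff h)
  have er: "continuous_on UNIV (\<lambda>x. eta_rate (?h x) (?w x) j)" for j
    unfolding eta_rate_def
    by (cases "j = 0") (auto intro!: continuous_on_add continuous_on_scaleR continuous_on_const mult h w dis)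
  have orr: "continuous_on UNIV (\<lambda>x. om_rate (?h x) j)" for j
    unfolding om_rate_def by (intro continuous_on_scaleR continuous_on_const mult h dis)
  let ?r = "\<lambda>x. ref_vel (?h x i) (?w x i) (?q x)"
  let ?r' = "\<lambda>x. ref_acc (?h x i) (?w x i) (eta_rate (?h x) (?w x) i) (om_rate (?h x) i) (?qd x)"
  let ?Y = "\<lambda>x. Y i (?q x) (?qd x) (?r' x) (?r x)"
  have r: "continuous_on UNIV ?r"
    unfolding ref_vel_def by (intro continuous_on_diff continuous_on_scaleR continuous_on_const mult h w q)
  have r': "continuous_on UNIV ?r'"
    unfolding ref_acc_def
    by (intro continuous_on_add continuous_on_diff continuous_on_scaleR continuous_on_const mult h w qd er orr)
  consider "i = 0" | "i \<in> {1..N}" | "i > N" by fastforce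
  then show ?thesis
  proof cases
    case 1
    then show ?thesis by (simp add: closed_loop_field_def Let_def continuous_on_Pair er)
  next
    case 2
    interpret el: euler_lagrange "M i" "DM i" "Cc i" "G i" "Y i" "Theta i" "K i" "Lam i"
      by (rule follower[OF 2])
    have "continuous_on UNIV (M i)"
      using el.M_deriv by (meson continuous_at_imp_continuous_on has_derivative_continuous)
    from continuous_on_compose2[OF this q] have M: "continuous_on UNIV (\<lambda>x. M i (?q x))" by simp
    from continuous_on_compose2[OF G_cont[OF 2] q] have G: "continuous_on UNIV (\<lambda>x. G i (?q x))" by simp
    from continuous_on_compose2[OF el.Cc_cont continuous_on_Pair[OF q qd]]
    have C: "continuous_on UNIV (\<lambda>x. Cc i (?q x) (?qd x))" by simp
    from continuous_on_compose2[OF el.Y_cont continuous_on_Pair[OF q continuous_on_Pair[OF qd continuous_on_Pair[OF r' r]]]]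
    have Y: "continuous_on UNIV ?Y" by simp
    have YT: "continuous_on UNIV (\<lambda>x. transpose (?Y x))"
    proof -
      have "linear (transpose :: real^'p^'n \<Rightarrow> real^'n^'p)"
        by (auto intro!: linearI simp: transpose_def vec_eq_iff)
      then have "continuous_on UNIV (transpose :: real^'p^'n \<Rightarrow> real^'n^'p)"
        by (rule linear_continuous_on[OF linear_conv_bounded_linear[THEN iffD1]])
      from continuous_on_compose2[OF this Y] show ?thesis by simp
    qed
    obtain c where c: "c > 0" "\<And>x y. c * (norm y)\<^sup>2 \<le> y \<bullet> (M i x *v y)" using el.M_pd by blast
    have "continuous_on UNIV (\<lambda>x. (eta_rate (?h x) (?w x) i, om_rate (?h x) i, ?qd x,
           matrix_inv (M i (?q x)) *v (- (K i *v (?qd x - ?r x)) + ?Y x *v ?th x - Cc i (?q x) (?qd x) *v ?qd x - G i (?q x)),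
           - (matrix_inv (Lam i) *v (transpose (?Y x) *v (?qd x - ?r x)))))"
      by (intro continuous_on_Pair er orr qd continuous_on_matrix_inv_mult[OF c] M G C Y YT th r
          continuous_on_minus continuous_on_add continuous_on_diff mult continuous_on_const)
    moreover have "i \<noteq> 0" "i \<le> N" using 2 by auto
    ultimately show ?thesis unfolding closed_loop_field_def Let_def by (simp del: transpose_matrix_vector)
  next
    case 3
    then show ?thesis by (simp add: closed_loop_field_def Let_def)
  qed
qed

text \<open>Used on \<open>{0..t}\<close> for the a priori bound and on \<open>{0..}\<close> for the
  final solution. Positivity of \<open>M i\<close> makes the explicit acceleration solve the
  implicit plant equation.\<close>

lemma network_on_of_field:
  assumes x: "\<And>i t. t \<in> J \<Longrightarrow> (x i has_vector_derivative closed_loop_field (\<lambda>j. x j t) i) (at t within J)"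
  shows "network_on J (\<lambda>i t. fst (x i t)) (\<lambda>i t. fst (snd (x i t))) (\<lambda>i t. fst (snd (snd (x i t))))
    (\<lambda>i t. fst (snd (snd (snd (x i t))))) (\<lambda>i t. snd (snd (snd (snd (x i t)))))"
proof -
  note fst' = bounded_linear.has_vector_derivative[OF bounded_linear_fst]
    and snd' = bounded_linear.has_vector_derivative[OF bounded_linear_snd]
  let ?h = "\<lambda>i t. fst (x i t)" and ?w = "\<lambda>i t. fst (snd (x i t))" and ?q = "\<lambda>i t. fst (snd (snd (x i t)))"
    and ?qd = "\<lambda>i t. fst (snd (snd (snd (x i t))))" and ?th = "\<lambda>i t. snd (snd (snd (snd (x i t))))"
  let ?er = "\<lambda>i t. eta_rate (\<lambda>j. ?h j t) (\<lambda>j. ?w j t) i" and ?or = "\<lambda>i t. om_rate (\<lambda>j. ?h j t) i"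
  let ?r = "\<lambda>i t. ref_vel (?h i t) (?w i t) (?q i t)"
  let ?r' = "\<lambda>i t. ref_acc (?h i t) (?w i t) (?er i t) (?or i t) (?qd i t)"
  let ?Y = "\<lambda>i t. Y i (?q i t) (?qd i t) (?r' i t) (?r i t)"
  let ?acc = "\<lambda>i t. matrix_inv (M i (?q i t)) *v
    (- (K i *v (?qd i t - ?r i t)) + ?Y i t *v ?th i t - Cc i (?q i t) (?qd i t) *v ?qd i t - G i (?q i t))"
  have f: "closed_loop_field (\<lambda>j. x j t) i = (?er i t, ?or i t, ?qd i t, ?acc i t,
      - (matrix_inv (Lam i) *v (transpose (?Y i t) *v (?qd i t - ?r i t))))" if "i \<in> {1..N}" for i t
    using that by (auto simp: closed_loop_field_def Let_def simp del: transpose_matrix_vector)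
  have h: "(?h i has_vector_derivative ?er i t) (at t within J)" if "i \<le> N" "t \<in> J" for i t
  proof (cases "i = 0")
    case True
    then show ?thesis using fst'[OF x[OF that(2), of 0]] by (simp add: closed_loop_field_def Let_def)
  next
    case False
    then show ?thesis using fst'[OF x[OF that(2), of i]] f[of i t] that by simp
  qed
  have rest: "(?w i has_vector_derivative ?or i t) (at t within J)"
    "(?q i has_vector_derivative ?qd i t) (at t within J)"
    "(?qd i has_vector_derivative ?acc i t) (at t within J)"
    "(?th i has_vector_derivative - (matrix_inv (Lam i) *v (transpose (?Y i t) *v (?qd i t - ?r i t)))) (at t within J)"
    if "i \<in> {1..N}" "t \<in> J" for i t
  proof -
    note s1 = snd'[OF x[OF that(2), of i, unfolded f[OF that(1)]]]
    note s2 = snd'[OF s1] note s3 = snd'[OF s2] note s4 = snd'[OF s3]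
    show "(?w i has_vector_derivative ?or i t) (at t within J)" using fst'[OF s1] by simp
    show "(?q i has_vector_derivative ?qd i t) (at t within J)" using fst'[OF s2] by simp
    show "(?qd i has_vector_derivative ?acc i t) (at t within J)" using fst'[OF s3] by simp
    show "(?th i has_vector_derivative - (matrix_inv (Lam i) *v (transpose (?Y i t) *v (?qd i t - ?r i t)))) (at t within J)"
      using s4 by (simp del: transpose_matrix_vector)
  qed
  have acc: "M i (?q i t) *v ?acc i t + Cc i (?q i t) (?qd i t) *v ?qd i t + G i (?q i t)
      = - (K i *v (?qd i t - ?r i t)) + ?Y i t *v ?th i t" if i: "i \<in> {1..N}" for i t
  proof -
    obtain c where c: "c > 0" "\<And>x y. c * (norm y)\<^sup>2 \<le> y \<bullet> (M i x *v y)"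
      using euler_lagrange.M_pd[OF follower[OF i]] by blast
    have "M i (?q i t) *v ?acc i t = - (K i *v (?qd i t - ?r i t)) + ?Y i t *v ?th i t - Cc i (?q i t) (?qd i t) *v ?qd i t - G i (?q i t)"
    proof (rule matrix_inv_mult_vector)
      fix y :: "real^'n" assume "y \<noteq> 0"
      then have "0 < c * (norm y)\<^sup>2" using c(1) by simp
      then show "0 < y \<bullet> (M i (?q i t) *v y)" using c(2) less_le_trans by blast
    qed
    then show ?thesis by simp
  qed
  have r: "(?r i has_vector_derivative ?r' i t) (at t within J)" if "i \<in> {1..N}" "t \<in> J" for i t
    by (rule ref_vel_has_vector_derivative) (use h[of i t] rest[OF that] that in auto)
  have "observer_on J ?h ?w" unfolding observer_on_def using h rest(1) by blast
  moreover have "euler_lagrange.tracking_on (M i) (Cc i) (G i) (Y i) (K i) (Lam i) J (?r i) (?r' i) (?q i) (?qd i) (?th i)"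
    if i: "i \<in> {1..N}" for i
    unfolding euler_lagrange.tracking_on_def[OF follower[OF i]]
    using r[OF i] rest(2-4)[OF i] acc[OF i] by blast
  ultimately show ?thesis unfolding network_on_def by blast
qed

theorem network_solution_exists:
  obtains h w q qd th where "network_on {0..} h w q qd th" "\<And>i. i \<le> N \<Longrightarrow> h i 0 = h0 i"
    "\<And>i. i \<in> {1..N} \<Longrightarrow> w i 0 = w0 i \<and> q i 0 = q0 i \<and> qd i 0 = qd0 i \<and> th i 0 = th0 i"
proof -
  define x0 where "x0 i = (if i = 0 then (h0 0, 0) else if i \<le> N then (h0 i, w0 i, q0 i, qd0 i, th0 i) else 0)" for i
  obtain R where R: "\<And>T h w q qd th. T \<ge> 0 \<Longrightarrow> network_on {0..T} h w q qd th \<Longrightarrow>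
      (\<And>i. i \<le> N \<Longrightarrow> h i 0 = h0 i) \<Longrightarrow>
      (\<And>i. i \<in> {1..N} \<Longrightarrow> w i 0 = w0 i \<and> q i 0 = q0 i \<and> qd i 0 = qd0 i \<and> th i 0 = th0 i) \<Longrightarrow>
      (\<forall>i\<le>N. norm (h i T) \<le> R) \<and>
      (\<forall>i\<in>{1..N}. norm (w i T) \<le> R \<and> norm (q i T) \<le> R \<and> norm (qd i T) \<le> R \<and> norm (th i T) \<le> R)"
    using network_uniform_bound by blast
  have norm5: "norm (a, b, c, d, e) \<le> norm a + (norm b + (norm c + (norm d + norm e)))"
    for a :: "real^('l \<times> half)" and b :: "real^'l" and c d :: "real^'n" and e :: "real^'p"
    by (intro order_trans[OF norm_Pair_le] add_left_mono order_refl)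
  have "\<exists>x. (\<forall>i. x i 0 = x0 i) \<and>
    (\<forall>i t. t \<ge> 0 \<longrightarrow> (x i has_vector_derivative closed_loop_field (\<lambda>j. x j t) i) (at t within {0..}))"
  \<comment> \<open>The factor 5 counts the components of a node's state, each bounded by
    \<open>R\<close>.\<close>
  proof (rule Peano_a_priori[of closed_loop_field N x0 "5 * R"])
    fix i
    show "continuous_on UNIV (\<lambda>x. closed_loop_field x i)" by (rule continuous_closed_loop_field)
    show "closed_loop_field x i = 0" if "i > N" for x using that by (simp add: closed_loop_field_def Let_def)
    show "x0 i = 0" if "i > N" using that by (simp add: x0_def)
  next
    fix T x i t
    assume "(T::real) \<ge> 0" and init: "\<And>i. x i 0 = x0 i"
      and sol: "\<And>i t. t \<in> {0..T} \<Longrightarrow> (x i has_vector_derivative closed_loop_field (\<lambda>j. x j t) i) (at t within {0..T})"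
      and i: "i \<le> N" and t: "t \<in> {0..T}"
    \<comment> \<open>\<open>R\<close> bounds the state at the end of an interval, so the solution
      is cut off at \<open>t\<close>.\<close>
    have sol': "(x i has_vector_derivative closed_loop_field (\<lambda>j. x j s) i) (at s within {0..t})" if "s \<in> {0..t}" for i s
      using has_vector_derivative_within_subset[OF sol[of s i], of "{0..t}"] that t by auto
    have bound: "(\<forall>i\<le>N. norm (fst (x i t)) \<le> R) \<and>
      (\<forall>i\<in>{1..N}. norm (fst (snd (x i t))) \<le> R \<and> norm (fst (snd (snd (x i t)))) \<le> R \<and>
         norm (fst (snd (snd (snd (x i t))))) \<le> R \<and> norm (snd (snd (snd (snd (x i t))))) \<le> R)"
      by (rule R[OF _ network_on_of_field[OF sol']]) (use t in \<open>auto simp: init x0_def\<close>)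
    show "norm (x i t) \<le> 5 * R"
    proof (cases "i = 0")
      case True
      \<comment> \<open>The last four components of the leader have zero derivative and start at 0,
        so its state reduces to \<open>v\<close>.\<close>
      have "norm (snd (x 0 t) - snd (x 0 0)) \<le> 0 * (t - 0)"
      proof (rule norm_increment_le_linear[where f'="\<lambda>_. 0"])
        fix s assume "s \<in> {0..t}"
        from bounded_linear.has_vector_derivative[OF bounded_linear_snd sol'[OF this, of 0]]
        show "((\<lambda>t. snd (x 0 t)) has_vector_derivative 0) (at s within {0..t})"
          by (simp add: closed_loop_field_def Let_def)
      qed (use t in auto)
      then have "snd (x 0 t) = 0" using init[of 0] by (simp add: x0_def)
      then obtain a where a: "x 0 t = (a, 0)" by (metis prod.collapse)
      have "norm (fst (x 0 t)) \<le> R" using bound by simp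
      then have "norm (x 0 t) \<le> R" by (simp add: a norm_Pair)
      then show ?thesis using True order_trans[OF norm_ge_zero, of "x 0 t" R] by simp
    next
      case False
      then have "i \<in> {1..N}" using i by simp
      with bound i show ?thesis
        using norm5[of "fst (x i t)" "fst (snd (x i t))" "fst (snd (snd (x i t)))"
            "fst (snd (snd (snd (x i t))))" "snd (snd (snd (snd (x i t))))"]
        by (smt (verit) prod.collapse)
    qed
  qed blast
  then obtain x where x0: "\<And>i. x i 0 = x0 i"
    and x: "\<And>i t. t \<ge> 0 \<Longrightarrow> (x i has_vector_derivative closed_loop_field (\<lambda>j. x j t) i) (at t within {0..})"
    by blast
  show thesis
    by (rule that[OF network_on_of_field[of "{0..}" x]]) (use x in \<open>auto simp: x0 x0_def\<close>)
qed

end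

theorem theorem1:
  fixes N :: nat and E :: "nat \<Rightarrow> nat \<Rightarrow> bool"
    and M :: "nat \<Rightarrow> real^'n \<Rightarrow> real^'n^'n"
    and DM :: "nat \<Rightarrow> real^'n \<Rightarrow> real^'n \<Rightarrow> real^'n^'n"
    and Cc :: "nat \<Rightarrow> real^'n \<Rightarrow> real^'n \<Rightarrow> real^'n^'n"
    and G :: "nat \<Rightarrow> real^'n \<Rightarrow> real^'n"
    and Y :: "nat \<Rightarrow> real^'n \<Rightarrow> real^'n \<Rightarrow> real^'n \<Rightarrow> real^'n \<Rightarrow> real^'p^'n"
    and Theta :: "nat \<Rightarrow> real^'p"
    and K :: "nat \<Rightarrow> real^'n^'n" and Lam :: "nat \<Rightarrow> real^'p^'p"
    and Cm :: "real^('l::finite \<times> half)^'n"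
    and alpha mu1 mu2 :: real
    and om0 :: "real^'l"
  assumes N_pos: "N \<ge> 1"
    and P1_sym: "\<forall>i\<in>{1..N}. \<forall>x. transpose (M i x) = M i x"
    and P1_pd: "\<forall>i\<in>{1..N}. \<exists>c>0. \<forall>x y. c * (norm y)\<^sup>2 \<le> y \<bullet> (M i x *v y)"
    and P2: "\<forall>i\<in>{1..N}. \<forall>x xd a b.
               M i x *v a + Cc i x xd *v b + G i x = Y i x xd a b *v Theta i"
    and M_deriv: "\<forall>i\<in>{1..N}. \<forall>x. (M i has_derivative DM i x) (at x)"
    and P3: "\<forall>i\<in>{1..N}. \<forall>x xd.
               transpose (DM i x xd - 2 *\<^sub>R Cc i x xd) = - (DM i x xd - 2 *\<^sub>R Cc i x xd)"
    and Cc_cont: "\<forall>i\<in>{1..N}. continuous_on UNIV (\<lambda>(x, xd). Cc i x xd)"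
    and G_cont: "\<forall>i\<in>{1..N}. continuous_on UNIV (G i)"
    and Y_cont: "\<forall>i\<in>{1..N}. continuous_on UNIV (\<lambda>(x, xd, a, b). Y i x xd a b)"
    and om0_pos: "\<forall>k. om0 $ k > 0"
    and tree: "has_spanning_tree_rooted {0..N} E 0"
    and undirected: "\<forall>i\<in>{1..N}. \<forall>j\<in>{1..N}. E j i \<longleftrightarrow> E i j"
    and alpha_pos: "alpha > 0" and mu1_pos: "mu1 > 0" and mu2_pos: "mu2 > 0"
    and K_pd: "\<forall>i\<in>{1..N}. pos_def_mat (K i)"
    and Lam_pd: "\<forall>i\<in>{1..N}. pos_diag_mat (Lam i)"
  shows "(\<forall>v00 q00 qd00 eta00 om00 th00.
            \<exists>v q qd eta om th.
              closed_loop N E M Cc G Y K Lam Cm alpha mu1 mu2 om0 v q qd eta om th \<and>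
              v 0 = v00 \<and>
              (\<forall>i\<in>{1..N}. q i 0 = q00 i \<and> qd i 0 = qd00 i \<and> eta i 0 = eta00 i \<and>
                            om i 0 = om00 i \<and> th i 0 = th00 i))
       \<and> (\<forall>v q qd eta om th.
            closed_loop N E M Cc G Y K Lam Cm alpha mu1 mu2 om0 v q qd eta om th \<longrightarrow>
            (\<forall>i\<in>{1..N}.
               bounded (q i ` {0..}) \<and> bounded (qd i ` {0..}) \<and> bounded (eta i ` {0..}) \<and>
               bounded (om i ` {0..}) \<and> bounded (th i ` {0..}) \<and>
               ((\<lambda>t. q i t - Cm *v v t) \<longlongrightarrow> 0) at_top \<and>
               ((\<lambda>t. qd i t - Cm *v (Smat om0 *v v t)) \<longlongrightarrow> 0) at_top))"
proof -
  interpret el_network N E mu1 mu2 om0 M DM Cc G Y Theta K Lam Cm alpha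
  proof (intro el_network.intro observer_network.intro leader_follower_graph.intro
      observer_network_axioms.intro el_network_axioms.intro)
    fix i assume i: "i \<in> {1..N}"
    show "euler_lagrange (M i) (DM i) (Cc i) (G i) (Y i) (Theta i) (K i) (Lam i)"
      by unfold_locales (use i P1_sym P1_pd P2 M_deriv P3 Cc_cont Y_cont K_pd Lam_pd in \<open>blast+\<close>)
  qed (use tree undirected mu1_pos mu2_pos alpha_pos G_cont in auto)
  show ?thesis
  proof (intro conjI allI impI ballI)
    fix v00 q00 qd00 eta00 om00 th00
    obtain h w q qd th where net: "network_on {0..} h w q qd th"
      and h0: "\<And>i. i \<le> N \<Longrightarrow> h i 0 = (if i = 0 then v00 else eta00 i)"
      and init: "\<And>i. i \<in> {1..N} \<Longrightarrow> w i 0 = om00 i \<and> q i 0 = q00 i \<and> qd i 0 = qd00 i \<and> th i 0 = th00 i"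
      using network_solution_exists[of "\<lambda>i. if i = 0 then v00 else eta00 i" om00 q00 qd00 th00] by blast
    \<comment> \<open>Leader and estimates come as one family; entry 0 supplies \<open>v\<close>,
      and merging it back changes nothing.\<close>
    have "(\<lambda>i. if i = 0 then h 0 else h i) = h" by auto
    with net have "closed_loop N E M Cc G Y K Lam Cm alpha mu1 mu2 om0 (h 0) q qd h w th"
      by (simp add: closed_loop_iff_network_on)
    moreover have "h 0 0 = v00" using h0[of 0] by simp
    moreover have "\<forall>i\<in>{1..N}. q i 0 = q00 i \<and> qd i 0 = qd00 i \<and> h i 0 = eta00 i \<and> w i 0 = om00 i \<and> th i 0 = th00 i"
      using h0 init by auto
    ultimately show "\<exists>v q qd eta om th.
              closed_loop N E M Cc G Y K Lam Cm alpha mu1 mu2 om0 v q qd eta om th \<and>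
              v 0 = v00 \<and>
              (\<forall>i\<in>{1..N}. q i 0 = q00 i \<and> qd i 0 = qd00 i \<and> eta i 0 = eta00 i \<and>
                            om i 0 = om00 i \<and> th i 0 = th00 i)"
      by blast
  next
    fix v q qd eta om th i
    assume "closed_loop N E M Cc G Y K Lam Cm alpha mu1 mu2 om0 v q qd eta om th" and i: "i \<in> {1..N}"
    then have net: "network_on {0..} (\<lambda>i. if i = 0 then v else eta i) om q qd th"
      by (simp add: closed_loop_iff_network_on)
    have "i \<noteq> 0" using i by simp
    with network_bounded[OF net i] network_tracks_leader[OF net i]
    show "bounded (q i ` {0..})" "bounded (qd i ` {0..})" "bounded (eta i ` {0..})"
      "bounded (om i ` {0..})" "bounded (th i ` {0..})"
      "((\<lambda>t. q i t - Cm *v v t) \<longlongrightarrow> 0) at_top"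
      "((\<lambda>t. qd i t - Cm *v (Smat om0 *v v t)) \<longlongrightarrow> 0) at_top"
      by simp_all
  qed
qed

end
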